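(* Let $\ell$ be a prime with $\ell\nmid p(p-1)$, and let $\pi_{p,1},\pi_{p,2}$ be unramified non-degenerate $\overline{\mathbf{F}}_\ell$-linear smooth representations of $H_p$ with $\omega_{\pi_{p,1}}(p)\neq\omega_{\pi_{p,2}}^{-1}(p)$ in $\overline{\mathbf{F}}_\ell^\times$. Then $$\dim_{\overline{\mathbf{F}}_\ell}\mathrm{Hom}_{P_p}(\pi_{p,1}\otimes\pi_{p,2},\delta_P)\leq1,$$ and every non-zero such linear form is non-vanishing on $W^{\mathrm{sph}}_{\pi_{p,1}}\otimes W^{\mathrm{sph}}_{\pi_{p,2}}$.
   Context: Let $p$ be a prime, $H_p=\mathrm{GL}_2(\mathbf{Q}_p)$, $H_p^\circ=\mathrm{GL}_2(\mathbf{Z}_p)$. Let $\ell\neq p$ be a prime; fix compatible choices of $p^i\in\overline{\mathbf{F}}_\ell$ (reductions of fixed elements of $\overline{\mathbf{Z}}_\ell$). $P_p=\{\left(\begin{smallmatrix}a&b\\0&1\end{smallmatrix}\right)\}\subset H_p$ acts on $\pi_{p,1}\otimes\pi_{p,2}$ diagonally, and $\delta_P:P_p\to\overline{\mathbf{F}}_\ell^\times$ is $\delta_P\left(\begin{smallmatrix}a&b\\0&1\end{smallmatrix}\right)=p^{-v_p(a)}$; $\mathrm{Hom}_{P_p}(\pi_{p,1}\otimes\pi_{p,2},\delta_P)$ consists of linear forms $\lambda$ with $\lambda(xv)=\delta_P(x)\lambda(v)$. An unramified $\overline{\mathbf{F}}_\ell$-linear smooth $H_p$-representation $\pi$ is non-degenerate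 if $\dim\pi^{H_p^\circ}=1$ and $\pi^{H_p^\circ}$ generates $\pi$; $W^{\mathrm{sph}}_\pi$ denotes a nonzero spherical vector. $\omega_\pi$ is the central character and $\omega_\pi(p)$ its value on $pI$. *)

theory Defs
  imports
    "HOL-Analysis.Analysis"
    "HOL-Algebra.Algebraic_Closure_Type"
    "HOL-Library.Poly_Mapping"
    "HOL-Library.Function_Algebras"
    "Berlekamp_Zassenhaus.Finite_Field"
begin

unbundle no fps_syntax

section \<open>The p-adic integers\<close>

text \<open>
  A prime enters as the cardinality of a type of class \<open>prime_card\<close>.  An element of the inverse
  limit of the rings Z/p^n is represented by the sequence of its least nonnegative residues.
\<close>

typedef (overloaded) ('p :: prime_card) padic_int =
  "{f :: nat \<Rightarrow> int. \<forall>n. 0 \<le> f n \<and> f n < int CARD('p) ^ n \<and>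
      f (Suc n) mod int CARD('p) ^ n = f n}"
  morphisms padic_residue Abs_padic_int
  by (rule exI[of _ "\<lambda>_. 0"]) (auto simp: prime_card_int prime_gt_0_int)

setup_lifting type_definition_padic_int

lemma CARD_prime_pos [simp]: "0 < int CARD('p :: prime_card) ^ n"
  by simp

lemma padic_mod_mod: "(x :: int) mod int CARD('p :: prime_card) ^ Suc n mod int CARD('p) ^ n
    = x mod int CARD('p) ^ n"
  by (rule mod_mod_cancel) (simp add: le_imp_power_dvd)

instantiation padic_int :: (prime_card) comm_ring_1
begin

lift_definition zero_padic_int :: "'a padic_int" is "\<lambda>_. 0" by simp
lift_definition one_padic_int :: "'a padic_int" is "\<lambda>n. 1 mod int CARD('a) ^ n"
  by (simp add: padic_mod_mod del: power_Suc)
lift_definition plus_padic_int :: "'a padic_int \<Rightarrow> 'a padic_int \<Rightarrow> 'a padic_int"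
  is "\<lambda>f g n. (f n + g n) mod int CARD('a) ^ n"
  by (simp add: padic_mod_mod del: power_Suc) (metis mod_add_eq)
lift_definition minus_padic_int :: "'a padic_int \<Rightarrow> 'a padic_int \<Rightarrow> 'a padic_int"
  is "\<lambda>f g n. (f n - g n) mod int CARD('a) ^ n"
  by (simp add: padic_mod_mod del: power_Suc) (metis mod_diff_eq)
lift_definition uminus_padic_int :: "'a padic_int \<Rightarrow> 'a padic_int"
  is "\<lambda>f n. (- f n) mod int CARD('a) ^ n"
  by (simp add: padic_mod_mod del: power_Suc) (metis mod_minus_eq)
lift_definition times_padic_int :: "'a padic_int \<Rightarrow> 'a padic_int \<Rightarrow> 'a padic_int"
  is "\<lambda>f g n. (f n * g n) mod int CARD('a) ^ n"
  by (simp add: padic_mod_mod del: power_Suc) (metis mod_mult_eq)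

instance
proof
  show "(0 :: 'a padic_int) \<noteq> 1"
  proof transfer
    have "(1 :: int) mod int CARD('a) ^ 1 = 1"
      using prime_gt_1_int[OF prime_card_int[where 'a='a]] by simp
    then show "(\<lambda>_. 0) \<noteq> (\<lambda>n. 1 mod int CARD('a) ^ n)" by (metis zero_neq_one)
  qed
qed (transfer; auto simp: fun_eq_iff mod_simps algebra_simps)+

end

lemma padic_residue_bounds:
  "0 \<le> padic_residue (x :: 'p :: prime_card padic_int) n" "padic_residue x n < int CARD('p) ^ n"
  using padic_residue[of x] by auto

lemma padic_residue_mod:
  assumes "m \<le> n"
  shows "padic_residue (x :: 'p :: prime_card padic_int) n mod int CARD('p) ^ m = padic_residue x m"
  using assms
proof (induction n rule: dec_induct)
  case base
  then show ?case by (simp add: padic_residue_bounds)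
next
  case (step n)
  have "int CARD('p) ^ m dvd int CARD('p) ^ n" using step by (simp add: le_imp_power_dvd)
  then have "padic_residue x (Suc n) mod int CARD('p) ^ m
      = padic_residue x (Suc n) mod int CARD('p) ^ n mod int CARD('p) ^ m"
    by (simp add: mod_mod_cancel)
  then show ?case using step padic_residue[of x] by simp
qed

lemma padic_residue_eqI:
  "(\<And>n. padic_residue x n = padic_residue y n) \<Longrightarrow> x = y"
  by (metis padic_residue_inject ext)

lemma padic_residue_of_nat:
  "padic_residue (of_nat k :: 'p :: prime_card padic_int) n = int k mod int CARD('p) ^ n"
  by (induction k) (simp_all add: zero_padic_int.rep_eq plus_padic_int.rep_eq one_padic_int.rep_eq mod_simps)

instance padic_int :: (prime_card) idom
proof
  fix x y :: "'a padic_int"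
  let ?p = "int CARD('a)"
  assume "x \<noteq> 0" "y \<noteq> 0"
  then obtain a b where ab: "padic_residue x a \<noteq> 0" "padic_residue y b \<noteq> 0"
    by (metis padic_residue_eqI zero_padic_int.rep_eq)
  let ?x = "padic_residue x (a + b)" and ?y = "padic_residue y (a + b)"
  have x: "\<not> ?p ^ a dvd ?x" and y: "\<not> ?p ^ b dvd ?y"
    using ab padic_residue_mod[of a "a + b" x] padic_residue_mod[of b "a + b" y] by auto
  have p: "prime_elem ?p" using prime_card_int[where 'a='a] by auto
  have nz: "?x \<noteq> 0" "?y \<noteq> 0" using x y by auto
  have "multiplicity ?p ?x < a" "multiplicity ?p ?y < b"
    using x y nz by (meson multiplicity_dvd' not_le)+
  then have "multiplicity ?p (?x * ?y) < a + b"
    using p nz by (simp add: prime_elem_multiplicity_mult_distrib)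
  then have "\<not> ?p ^ (a + b) dvd ?x * ?y"
    using nz p by (metis multiplicity_geI mult_eq_0_iff not_le prime_elem_not_unit)
  then have "padic_residue (x * y) (a + b) \<noteq> 0" by (simp add: times_padic_int.rep_eq dvd_eq_mod_eq_0)
  then show "x * y \<noteq> 0" by (auto simp: zero_padic_int.rep_eq)
qed

lemma padic_int_p_nonzero: "(of_nat CARD('p) :: 'p :: prime_card padic_int) \<noteq> 0"
proof
  assume "(of_nat CARD('p) :: 'p padic_int) = 0"
  then have "int CARD('p) mod int CARD('p) ^ 2 = 0"
    by (metis padic_residue_of_nat zero_padic_int.rep_eq)
  moreover have "int CARD('p) < int CARD('p) ^ 2"
    using prime_gt_1_int[OF prime_card_int[where 'a='p]] by (simp add: power2_eq_square)
  ultimately show False by simp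
qed

lemma padic_int_p_not_unit: "\<not> (of_nat CARD('p) :: 'p :: prime_card padic_int) dvd 1"
proof
  assume "(of_nat CARD('p) :: 'p padic_int) dvd 1"
  then obtain y :: "'p padic_int" where "1 = of_nat CARD('p) * y" by blast
  then have "padic_residue (1 :: 'p padic_int) 1 = padic_residue (of_nat CARD('p) * y) 1" by simp
  then show False using prime_gt_1_int[OF prime_card_int[where 'a='p]]
    by (simp add: one_padic_int.rep_eq times_padic_int.rep_eq padic_residue_of_nat)
qed

lemma padic_int_unit:
  fixes x :: "'p :: prime_card padic_int"
  assumes "padic_residue x 1 \<noteq> 0"
  shows "x dvd 1"
proof -
  let ?p = "int CARD('p)"
  have "coprime (padic_residue x n) (?p ^ n)" for n
  proof (cases "n = 0")
    case False
    then have "\<not> ?p dvd padic_residue x n"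
      using assms padic_residue_mod[of 1 n x] by auto
    then have "coprime ?p (padic_residue x n)"
      using prime_card_int[where 'a='p] by (intro prime_imp_coprime) auto
    then show ?thesis by (simp add: coprime_commute)
  qed auto
  then have "\<exists>v. [padic_residue x n * v = 1] (mod ?p ^ n)" for n
    by (rule cong_solve_coprime_int)
  then obtain v where v: "\<And>n. [padic_residue x n * v n = 1] (mod ?p ^ n)" by metis
  define w where "w n = v n mod ?p ^ n" for n
  have w: "[padic_residue x n * w n = 1] (mod ?p ^ n)" for n
    using v[of n] by (simp add: w_def cong_def mod_simps)
  have "w (Suc n) mod ?p ^ n = w n" for n
  proof -
    have "?p ^ n dvd ?p ^ Suc n" by (simp add: le_imp_power_dvd)
    then have "[padic_residue x (Suc n) * w (Suc n) = 1] (mod ?p ^ n)"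
      using w[of "Suc n"] cong_dvd_modulus by blast
    moreover have "[padic_residue x (Suc n) = padic_residue x n] (mod ?p ^ n)"
      using padic_residue_mod[of n "Suc n" x] padic_residue_mod[of n n x] by (simp add: cong_def)
    ultimately have 1: "[padic_residue x n * w (Suc n) = 1] (mod ?p ^ n)"
      by (metis cong_scalar_right cong_sym cong_trans)
    have "[w (Suc n) = (padic_residue x n * w n) * w (Suc n)] (mod ?p ^ n)"
      using cong_scalar_right[OF w[of n], of "w (Suc n)"] by (simp add: cong_sym)
    also have "(padic_residue x n * w n) * w (Suc n) = (padic_residue x n * w (Suc n)) * w n"
      by (simp add: ac_simps)
    also have "[\<dots> = w n] (mod ?p ^ n)" using cong_scalar_right[OF 1, of "w n"] by simp
    finally show ?thesis by (simp add: cong_def w_def)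
  qed
  then have "w \<in> {f. \<forall>n. 0 \<le> f n \<and> f n < ?p ^ n \<and> f (Suc n) mod ?p ^ n = f n}"
    by (simp add: w_def)
  then have "padic_residue (Abs_padic_int w :: 'p padic_int) = w" by (rule Abs_padic_int_inverse)
  then have "x * Abs_padic_int w = 1"
    using w by (intro padic_residue_eqI)
      (simp add: times_padic_int.rep_eq one_padic_int.rep_eq cong_def)
  then show ?thesis by (metis dvd_triv_left)
qed

lemma padic_int_decomp:
  fixes x :: "'p :: prime_card padic_int"
  assumes "x \<noteq> 0"
  obtains n u where "u dvd 1" "x = of_nat CARD('p) ^ n * u"
proof -
  let ?p = "int CARD('p)"
  have "\<exists>m. padic_residue x m \<noteq> 0" using assms by (metis padic_residue_eqI zero_padic_int.rep_eq)
  then obtain m where m: "padic_residue x m \<noteq> 0" and least: "\<And>k. k < m \<Longrightarrow> padic_residue x k = 0"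
    using exists_least_iff[of "\<lambda>m. padic_residue x m \<noteq> 0"] by blast
  have "m \<noteq> 0" using m padic_residue_bounds[of x 0] by (auto intro!: Nat.gr0I)
  then obtain n where n: "m = Suc n" using not0_implies_Suc by blast
  have dvd: "?p ^ n dvd padic_residue x (n + k)" for k
    using least[of n] padic_residue_mod[of n "n + k" x] by (simp add: n dvd_eq_mod_eq_0)
  define f where "f k = padic_residue x (n + k) div ?p ^ n" for k
  have f: "padic_residue x (n + k) = ?p ^ n * f k" for k using dvd by (simp add: f_def)
  have pn: "0 < ?p ^ n" by simp
  have "0 \<le> f k \<and> f k < ?p ^ k \<and> f (Suc k) mod ?p ^ k = f k" for k
  proof -
    have "?p ^ n * f (Suc k) mod (?p ^ n * ?p ^ k) = ?p ^ n * f k"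
      using padic_residue_mod[of "n + k" "n + Suc k" x]
      unfolding f[of k] f[of "Suc k"] power_add by simp
    then have "f (Suc k) mod ?p ^ k = f k" using pn by (simp add: mult_mod_right[symmetric])
    moreover have "0 \<le> f k" using padic_residue_bounds(1)[of x "n + k"] by (simp add: f_def pos_imp_zdiv_nonneg_iff)
    moreover have "?p ^ n * f k < ?p ^ n * ?p ^ k"
      using padic_residue_bounds(2)[of x "n + k"] by (simp only: f power_add)
    ultimately show ?thesis using pn by simp
  qed
  then have rep: "padic_residue (Abs_padic_int f :: 'p padic_int) = f"
    by (intro Abs_padic_int_inverse) auto
  have "f 1 \<noteq> 0" using m f[of 1] by (simp add: n)
  then have "(Abs_padic_int f :: 'p padic_int) dvd 1" using rep by (intro padic_int_unit) simp
  moreover have "x = of_nat CARD('p) ^ n * Abs_padic_int f"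
  proof (rule padic_residue_eqI)
    fix k
    have "[f k * ?p ^ n = padic_residue x k] (mod ?p ^ k)"
      using padic_residue_mod[of k "n + k" x] padic_residue_mod[of k k x] f[of k]
      by (simp add: cong_def mult.commute)
    then have "padic_residue x k = ?p ^ n * f k mod ?p ^ k"
      by (simp add: cong_def mult.commute padic_residue_mod)
    moreover have "padic_residue (of_nat CARD('p) ^ n :: 'p padic_int) k = ?p ^ n mod ?p ^ k"
      using padic_residue_of_nat[of "CARD('p) ^ n" k, where 'p='p] by simp
    ultimately show "padic_residue x k = padic_residue (of_nat CARD('p) ^ n * Abs_padic_int f :: 'p padic_int) k"
      by (simp add: times_padic_int.rep_eq rep mod_simps)
  qed
  ultimately show thesis by (rule that)
qed


section \<open>The field of p-adic numbers\<close>

text \<open>A copy of the fraction field, so that it can carry the p-adic topology as a class instance.\<close>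

typedef (overloaded) ('p :: prime_card) padic = "UNIV :: 'p padic_int fract set"
  morphisms Rep_padic Abs_padic
  by blast

setup_lifting type_definition_padic

instantiation padic :: (prime_card) comm_ring_1
begin

lift_definition zero_padic :: "'a padic" is 0 .
lift_definition one_padic :: "'a padic" is 1 .
lift_definition plus_padic :: "'a padic \<Rightarrow> 'a padic \<Rightarrow> 'a padic" is "(+)" .
lift_definition minus_padic :: "'a padic \<Rightarrow> 'a padic \<Rightarrow> 'a padic" is "(-)" .
lift_definition uminus_padic :: "'a padic \<Rightarrow> 'a padic" is uminus .
lift_definition times_padic :: "'a padic \<Rightarrow> 'a padic \<Rightarrow> 'a padic" is "(*)" .

instance
proof
  fix a b c :: "'a padic"
  show "a + b + c = a + (b + c)" "a * b * c = a * (b * c)" by (transfer; simp add: ac_simps)+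
  show "a + b = b + a" "a * b = b * a" by (transfer; simp add: ac_simps)+
  show "0 + a = a" "1 * a = a" "- a + a = 0" "a - b = a + - b" by (transfer; simp)+
  show "(a + b) * c = a * c + b * c" by transfer (rule distrib_right)
  show "(0 :: 'a padic) \<noteq> 1" by transfer simp
qed

end

instantiation padic :: (prime_card) field
begin

lift_definition inverse_padic :: "'a padic \<Rightarrow> 'a padic" is inverse .
definition divide_padic :: "'a padic \<Rightarrow> 'a padic \<Rightarrow> 'a padic"
  where "divide_padic x y = x * inverse y"

instance
proof
  fix a b :: "'a padic"
  show "a \<noteq> 0 \<Longrightarrow> inverse a * a = 1"
    by (simp add: Rep_padic_inject[symmetric] zero_padic.rep_eq one_padic.rep_eq times_padic.rep_eq inverse_padic.rep_eq)
  show "a div b = a * inverse b"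
    by (rule divide_padic_def)
  show "inverse 0 = (0 :: 'a padic)"
    unfolding Rep_padic_inject[symmetric] zero_padic.rep_eq inverse_padic.rep_eq by (rule inverse_zero)
qed

end

definition of_padic_int :: "'p :: prime_card padic_int \<Rightarrow> 'p padic" where
  "of_padic_int x = Abs_padic (Fract x 1)"

definition Zp :: "'p :: prime_card padic set" where
  "Zp = range of_padic_int"

definition Zp_units :: "'p :: prime_card padic set" where
  "Zp_units = {u \<in> Zp. \<exists>w \<in> Zp. u * w = 1}"

abbreviation padic_p :: "'p :: prime_card padic" where
  "padic_p \<equiv> of_nat CARD('p)"

text \<open>For \<open>x = 0\<close> the value is unspecified.\<close>

definition padic_val :: "'p :: prime_card padic \<Rightarrow> int" where
  "padic_val x = (THE n. \<exists>u \<in> Zp_units. x = padic_p powi n * u)"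

lemma Rep_of_padic_int: "Rep_padic (of_padic_int x) = Fract x 1"
  by (simp add: of_padic_int_def Abs_padic_inverse)

lemma of_padic_int_simps [simp]:
  "of_padic_int 0 = 0" "of_padic_int 1 = 1"
  "of_padic_int (x + y) = of_padic_int x + of_padic_int y"
  "of_padic_int (x * y) = of_padic_int x * of_padic_int y"
  by (simp_all add: Rep_padic_inject[symmetric] Rep_of_padic_int zero_padic.rep_eq one_padic.rep_eq
      plus_padic.rep_eq times_padic.rep_eq Zero_fract_def One_fract_def)

lemma of_padic_int_of_nat [simp]: "of_padic_int (of_nat n) = of_nat n"
  by (induction n) auto

lemma of_padic_int_power [simp]: "of_padic_int (x ^ n) = of_padic_int x ^ n"
  by (induction n) auto

lemma of_padic_int_eq_iff [simp]: "of_padic_int x = of_padic_int y \<longleftrightarrow> x = y"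
  by (simp add: Rep_padic_inject[symmetric] Rep_of_padic_int eq_fract)

lemma padic_p_nonzero: "(padic_p :: 'p :: prime_card padic) \<noteq> 0"
  using padic_int_p_nonzero[where 'p='p] of_padic_int_eq_iff[of "of_nat CARD('p)" "0 :: 'p padic_int"] by simp

lemma padic_fraction:
  obtains a b where "b \<noteq> 0" "x = of_padic_int a / of_padic_int b"
proof (cases "Rep_padic x")
  case (Fract a b)
  then have "x = of_padic_int a / of_padic_int b"
    by (simp add: Rep_padic_inject[symmetric] Rep_of_padic_int divide_padic_def times_padic.rep_eq inverse_padic.rep_eq)
  then show thesis using Fract that by blast
qed

lemma Zp_unitsI:
  assumes "a * b = 1"
  shows "of_padic_int a \<in> Zp_units"
proof -
  have "of_padic_int a * of_padic_int b = of_padic_int (a * b)" by simp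
  also have "\<dots> = 1" unfolding assms by simp
  finally show ?thesis unfolding Zp_units_def Zp_def by blast
qed

lemma Zp_unitsE:
  assumes "u \<in> Zp_units"
  obtains a b where "u = of_padic_int a" "a * b = 1"
proof -
  from assms obtain a b where ab: "u = of_padic_int a" "of_padic_int a * of_padic_int b = (1 :: 'a padic)"
    unfolding Zp_units_def Zp_def by blast
  have "of_padic_int (a * b) = (of_padic_int 1 :: 'a padic)" using ab(2) by simp
  then have "a * b = 1" unfolding of_padic_int_eq_iff .
  with ab(1) show thesis by (rule that)
qed

lemma Zp_units_of_padic_int: "u dvd 1 \<Longrightarrow> of_padic_int u \<in> Zp_units"
  by (erule dvdE) (rule Zp_unitsI, rule sym)

lemma Zp_units_divide:
  assumes "u \<in> Zp_units" "v \<in> Zp_units"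
  shows "u / v \<in> Zp_units"
proof -
  obtain a a' where a: "u = of_padic_int a" "a * a' = 1" using assms(1) by (rule Zp_unitsE)
  obtain b b' where b: "v = of_padic_int b" "b * b' = 1" using assms(2) by (rule Zp_unitsE)
  have "of_padic_int b * of_padic_int b' = (of_padic_int (b * b') :: 'a padic)" by simp
  then have "v * of_padic_int b' = 1" unfolding b by simp
  then have "inverse v = of_padic_int b'" by (rule inverse_unique)
  then have "u / v = of_padic_int (a * b')" unfolding a divide_inverse by simp
  moreover have "(a * b') * (a' * b) = (a * a') * (b * b')" by (simp only: ac_simps)
  then have "(a * b') * (a' * b) = 1" unfolding a b by simp
  ultimately show ?thesis using Zp_unitsI by metis
qed

lemma padic_val_ex1:
  fixes x :: "'p :: prime_card padic"
  assumes "x \<noteq> 0"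
  shows "\<exists>!n. \<exists>u \<in> Zp_units. x = padic_p powi n * u"
proof (rule ex_ex1I)
  obtain a b where b: "b \<noteq> 0" and x: "x = of_padic_int a / of_padic_int b" by (rule padic_fraction)
  with assms have a: "a \<noteq> 0" by auto
  obtain m u where u: "u dvd 1" "a = of_nat CARD('p) ^ m * u" using padic_int_decomp[OF a] .
  obtain n v where v: "v dvd 1" "b = of_nat CARD('p) ^ n * v" using padic_int_decomp[OF b] .
  have "x = padic_p powi (int m - int n) * (of_padic_int u / of_padic_int v)"
    using padic_p_nonzero[where 'p='p] by (simp add: x u v power_int_diff)
  then show "\<exists>n. \<exists>u \<in> Zp_units. x = padic_p powi n * u"
    using Zp_units_divide Zp_units_of_padic_int u(1) v(1) by blast
next
  have *: "n \<le> m" if u: "u \<in> Zp_units" and v: "v \<in> Zp_units"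
    and eq: "padic_p powi m * u = padic_p powi n * v" for m n :: int and u v :: "'p padic"
  proof (rule ccontr)
    assume "\<not> n \<le> m"
    then obtain k where k: "n = m + 1 + int k" using zle_iff_zadd[of "m + 1" n] by auto
    have "u \<noteq> 0" "v \<noteq> 0" using u v by (auto simp: Zp_units_def)
    have "u = padic_p * (padic_p ^ k * v)" using eq padic_p_nonzero[where 'p='p]
      by (simp add: k power_int_add ac_simps)
    then have 1: "u / v = padic_p * padic_p ^ k" using \<open>v \<noteq> 0\<close> by simp
    obtain w where w: "w \<in> Zp" "u / v * w = 1"
      using Zp_units_divide[OF u v] unfolding Zp_units_def by blast
    obtain w' where w': "w = of_padic_int w'" using w by (auto simp: Zp_def)
    have "of_padic_int (of_nat CARD('p) * (of_nat CARD('p) ^ k * w')) = of_padic_int 1"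
      using w(2) unfolding 1 w' by (simp add: ac_simps)
    then have "of_nat CARD('p) * (of_nat CARD('p) ^ k * w') = 1"
      unfolding of_padic_int_eq_iff .
    then show False using padic_int_p_not_unit[where 'p='p] by (metis dvd_triv_left)
  qed
  show "m = n" if "\<exists>u \<in> Zp_units. x = padic_p powi m * u" "\<exists>u \<in> Zp_units. x = padic_p powi n * u" for m n
    using that * by (metis order_antisym)
qed

instantiation padic :: (prime_card) topological_space
begin

definition open_padic :: "'a padic set \<Rightarrow> bool" where
  "open_padic U \<longleftrightarrow> (\<forall>x \<in> U. \<exists>n :: nat. \<forall>z \<in> Zp. x + padic_p ^ n * z \<in> U)"

instance
proof
  show "open (UNIV :: 'a padic set)" by (simp add: open_padic_def)
next
  fix S T :: "'a padic set"
  assume S: "open S" and T: "open T"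
  show "open (S \<inter> T)" unfolding open_padic_def
  proof
    fix x assume "x \<in> S \<inter> T"
    then obtain m n where m: "\<forall>z \<in> Zp. x + padic_p ^ m * z \<in> S" and n: "\<forall>z \<in> Zp. x + padic_p ^ n * z \<in> T"
      using S T unfolding open_padic_def by blast
    have Z: "padic_p ^ k * z \<in> Zp" if z: "z \<in> Zp" for k and z :: "'a padic"
    proof -
      obtain y where "z = of_padic_int y" using z by (auto simp: Zp_def)
      then have "padic_p ^ k * z = of_padic_int (of_nat CARD('a) ^ k * y)" by simp
      then show ?thesis unfolding Zp_def by (rule range_eqI)
    qed
    have "x + padic_p ^ (m + n) * z \<in> S \<inter> T" if "z \<in> Zp" for z
      using m[rule_format, OF Z[OF that, of n]] n[rule_format, OF Z[OF that, of m]]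
      by (simp add: power_add ac_simps)
    then show "\<exists>n. \<forall>z \<in> Zp. x + padic_p ^ n * z \<in> S \<inter> T" by blast
  qed
next
  fix K :: "'a padic set set"
  assume "\<forall>S \<in> K. open S"
  then show "open (\<Union>K)" unfolding open_padic_def by (meson Union_iff)
qed

end


section \<open>The groups\<close>

definition GL2_Qp :: "('p :: prime_card padic ^ 2 ^ 2) set" where
  "GL2_Qp = {A. invertible A}"

definition GL2_Zp :: "('p :: prime_card padic ^ 2 ^ 2) set" where
  "GL2_Zp = {A. (\<forall>i j. A $ i $ j \<in> Zp) \<and>
     (\<exists>B. (\<forall>i j. B $ i $ j \<in> Zp) \<and> A ** B = mat 1 \<and> B ** A = mat 1)}"

definition mirabolic :: "('p :: prime_card padic ^ 2 ^ 2) set" where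
  "mirabolic = {vector [vector [a, b], vector [0, 1]] | a b. a \<noteq> 0}"

definition delta_P :: "'p :: prime_card padic ^ 2 ^ 2 \<Rightarrow> 'k :: field" where
  "delta_P x = of_nat CARD('p) powi (- padic_val (x $ 1 $ 1))"


section \<open>Smooth representations\<close>

text \<open>
  A representation is given by the scalar multiplication \<open>s\<close> of a vector space whose underlying
  set is a whole type, and the action \<open>\<rho>\<close>, of which only the values on \<open>GL2_Qp\<close> matter.
\<close>

definition GL2_representation ::
    "('k :: field \<Rightarrow> 'v :: ab_group_add \<Rightarrow> 'v) \<Rightarrow> ('p :: prime_card padic ^ 2 ^ 2 \<Rightarrow> 'v \<Rightarrow> 'v) \<Rightarrow> bool" where
  "GL2_representation s \<rho> \<longleftrightarrow>
     vector_space s \<and>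
     (\<forall>g \<in> GL2_Qp. Vector_Spaces.linear s s (\<rho> g)) \<and>
     (\<forall>v. \<rho> (mat 1) v = v) \<and>
     (\<forall>g \<in> GL2_Qp. \<forall>h \<in> GL2_Qp. \<forall>v. \<rho> (g ** h) v = \<rho> g (\<rho> h v))"

text \<open>
  Inversion is continuous on \<open>GL2_Qp\<close>, so its topology is the subspace topology from the
  space of matrices.
\<close>

definition smooth_representation ::
    "('k :: field \<Rightarrow> 'v :: ab_group_add \<Rightarrow> 'v) \<Rightarrow> ('p :: prime_card padic ^ 2 ^ 2 \<Rightarrow> 'v \<Rightarrow> 'v) \<Rightarrow> bool" where
  "smooth_representation s \<rho> \<longleftrightarrow> GL2_representation s \<rho> \<and>
     (\<forall>v. openin (top_of_set GL2_Qp) {g \<in> GL2_Qp. \<rho> g v = v})"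

definition spherical :: "('p :: prime_card padic ^ 2 ^ 2 \<Rightarrow> 'v \<Rightarrow> 'v) \<Rightarrow> 'v set" where
  "spherical \<rho> = {v. \<forall>g \<in> GL2_Zp. \<rho> g v = v}"

definition unramified :: "('p :: prime_card padic ^ 2 ^ 2 \<Rightarrow> 'v :: zero \<Rightarrow> 'v) \<Rightarrow> bool" where
  "unramified \<rho> \<longleftrightarrow> (\<exists>v \<in> spherical \<rho>. v \<noteq> 0)"

definition nondegenerate ::
    "('k :: field \<Rightarrow> 'v :: ab_group_add \<Rightarrow> 'v) \<Rightarrow> ('p :: prime_card padic ^ 2 ^ 2 \<Rightarrow> 'v \<Rightarrow> 'v) \<Rightarrow> bool" where
  "nondegenerate s \<rho> \<longleftrightarrow>
     vector_space.dim s (spherical \<rho>) = 1 \<and>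
     module.span s {\<rho> g v | g v. g \<in> GL2_Qp \<and> v \<in> spherical \<rho>} = UNIV"

text \<open>
  Non-degenerate representations have a central character, since the center preserves the
  line of spherical vectors.  In general the value is unspecified.
\<close>

definition central_character ::
    "('k :: field \<Rightarrow> 'v :: ab_group_add \<Rightarrow> 'v) \<Rightarrow> ('p :: prime_card padic ^ 2 ^ 2 \<Rightarrow> 'v \<Rightarrow> 'v) \<Rightarrow> 'p padic \<Rightarrow> 'k" where
  "central_character s \<rho> z = (THE c. \<forall>v. \<rho> (mat z) v = s c v)"


lemma mat_commute: "mat z ** g = g ** (mat z :: 'k :: field ^ 'n ^ 'n)"
proof -
  have "(\<Sum>k\<in>UNIV. (if i = k then z else 0) * g $ k $ j) = (\<Sum>k\<in>UNIV. g $ i $ k * (if k = j then z else 0))"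
    for i j
  proof -
    have "(\<Sum>k\<in>UNIV. (if i = k then z else 0) * g $ k $ j) = (\<Sum>k\<in>UNIV. if i = k then z * g $ k $ j else 0)"
      by (intro sum.cong) auto
    moreover have "(\<Sum>k\<in>UNIV. g $ i $ k * (if k = j then z else 0)) = (\<Sum>k\<in>UNIV. if k = j then g $ i $ k * z else 0)"
      by (intro sum.cong) auto
    ultimately show ?thesis by (simp add: mult.commute)
  qed
  then show ?thesis by (simp add: matrix_matrix_mult_def mat_def vec_eq_iff)
qed

lemma central_character_ex1:
  fixes s :: "'k :: field \<Rightarrow> 'v :: ab_group_add \<Rightarrow> 'v" and z :: "'p :: prime_card padic"
  assumes rep: "GL2_representation s \<rho>" and nd: "nondegenerate s \<rho>" and z: "z \<noteq> 0"
  shows "\<exists>!c. \<forall>v. \<rho> (mat z) v = s c v"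
proof -
  note r = rep[unfolded GL2_representation_def]
  interpret vector_space s by (rule r[THEN conjunct1])
  have lin: "Vector_Spaces.linear s s (\<rho> g)" if "g \<in> GL2_Qp" for g
    by (rule bspec[OF r[THEN conjunct2, THEN conjunct1] that])
  have mult: "\<rho> (g ** h) v = \<rho> g (\<rho> h v)" if "g \<in> GL2_Qp" "h \<in> GL2_Qp" for g h v
    by (rule r[THEN conjunct2, THEN conjunct2, THEN conjunct2, rule_format, OF that])
  have Zp_sub: "g \<in> GL2_Qp" if "g \<in> GL2_Zp" for g :: "'p padic ^ 2 ^ 2"
    using that unfolding GL2_Qp_def GL2_Zp_def invertible_def mem_Collect_eq by (elim conjE exE) (intro exI conjI)
  have inv: "(mat z :: 'p padic ^ 2 ^ 2) ** mat (inverse z) = mat 1"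
    using z by (simp add: matrix_matrix_mult_def mat_def vec_eq_iff sum_2 forall_2)
  have zG: "(mat z :: 'p padic ^ 2 ^ 2) \<in> GL2_Qp"
    unfolding GL2_Qp_def invertible_def mem_Collect_eq
    by (intro exI[of _ "mat (inverse z)"] conjI inv) (simp only: inv mat_commute[of "inverse z"])
  have comm: "\<rho> (mat z) (\<rho> g v) = \<rho> g (\<rho> (mat z) v)" if "g \<in> GL2_Qp" for g v
    unfolding mult[OF zG that, symmetric] mult[OF that zG, symmetric] by (simp only: mat_commute)
  have "dim (spherical \<rho>) = 1" using nd by (simp add: nondegenerate_def)
  then obtain B where B: "B \<subseteq> spherical \<rho>" "independent B" "spherical \<rho> \<subseteq> span B" "card B = 1"
    using basis_exists[of "spherical \<rho>"] by metis
  then obtain w where w: "B = {w}" by (auto simp: card_1_singleton_iff)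
  have w0: "w \<noteq> 0" using B w dependent_zero by blast
  have ws: "w \<in> spherical \<rho>" using B w by auto
  have "\<rho> g (\<rho> (mat z) w) = \<rho> (mat z) w" if "g \<in> GL2_Zp" for g
    using ws that comm[OF Zp_sub[OF that], of w] by (simp add: spherical_def)
  then have "\<rho> (mat z) w \<in> spherical \<rho>" by (simp add: spherical_def)
  then obtain c where c: "\<rho> (mat z) w = s c w" using B w by (auto simp: span_singleton)
  have eq: "\<rho> (mat z) v = s c v" for v
  proof -
    interpret m: Vector_Spaces.linear s s "\<rho> (mat z)" using lin zG by blast
    have "v \<in> span {\<rho> g v | g v. g \<in> GL2_Qp \<and> v \<in> spherical \<rho>}"
      using nd by (simp add: nondegenerate_def)
    then show ?thesis
    proof (induction rule: span_induct)
      case base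
      show ?case by (auto simp: subspace_def m.zero m.add m.scale scale_right_distrib mult.commute)
    next
      case (step x)
      then obtain g y where g: "g \<in> GL2_Qp" and y: "y \<in> spherical \<rho>" and x: "x = \<rho> g y" by blast
      obtain d where d: "y = s d w" using y B w by (auto simp: span_singleton)
      interpret lg: Vector_Spaces.linear s s "\<rho> g" using lin g by blast
      have "\<rho> (mat z) x = \<rho> g (s d (s c w))" by (simp only: x comm[OF g] d m.scale c[symmetric])
      also have "\<dots> = s c x" by (simp add: x d lg.scale mult.commute)
      finally show ?case .
    qed
  qed
  show ?thesis
  proof (rule ex1I[of _ c])
    show "\<forall>v. \<rho> (mat z) v = s c v" using eq by blast
    show "c' = c" if "\<forall>v. \<rho> (mat z) v = s c' v" for c'
      using that eq w0 by (metis scale_right_imp_eq)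
  qed
qed


section \<open>Tensor products\<close>

text \<open>
  The tensor product is the quotient of the free vector space on pairs by the span of the
  bilinearity relations.  Its elements are the cosets; addition, scalar multiplication and
  \<open>f \<otimes> g\<close> are defined on cosets through representatives.
\<close>

definition free_scale :: "'k :: field \<Rightarrow> ('b \<Rightarrow>\<^sub>0 'k) \<Rightarrow> ('b \<Rightarrow>\<^sub>0 'k)" where
  "free_scale c = Poly_Mapping.map ((*) c)"

definition free_map :: "('b \<Rightarrow> 'c) \<Rightarrow> ('b \<Rightarrow>\<^sub>0 'k :: field) \<Rightarrow> ('c \<Rightarrow>\<^sub>0 'k)" where
  "free_map f x = (\<Sum>b \<in> Poly_Mapping.keys x. Poly_Mapping.single (f b) (Poly_Mapping.lookup x b))"

abbreviation free_pair :: "'v \<Rightarrow> 'w \<Rightarrow> ('v \<times> 'w) \<Rightarrow>\<^sub>0 'k :: field" where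
  "free_pair v w \<equiv> Poly_Mapping.single (v, w) 1"

definition tensor_null ::
    "('k :: field \<Rightarrow> 'v :: ab_group_add \<Rightarrow> 'v) \<Rightarrow> ('k \<Rightarrow> 'w :: ab_group_add \<Rightarrow> 'w) \<Rightarrow> (('v \<times> 'w) \<Rightarrow>\<^sub>0 'k) set" where
  "tensor_null s1 s2 = module.span free_scale
     ({free_pair (v + v') w - free_pair v w - free_pair v' w | v v' w. True} \<union>
      {free_pair v (w + w') - free_pair v w - free_pair v w' | v w w'. True} \<union>
      {free_pair (s1 c v) w - free_scale c (free_pair v w) | c v w. True} \<union>
      {free_pair v (s2 c w) - free_scale c (free_pair v w) | c v w. True})"

definition tensor_class ::
    "('k :: field \<Rightarrow> 'v :: ab_group_add \<Rightarrow> 'v) \<Rightarrow> ('k \<Rightarrow> 'w :: ab_group_add \<Rightarrow> 'w) \<Rightarrow>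
     (('v \<times> 'w) \<Rightarrow>\<^sub>0 'k) \<Rightarrow> (('v \<times> 'w) \<Rightarrow>\<^sub>0 'k) set" where
  "tensor_class s1 s2 x = {y. y - x \<in> tensor_null s1 s2}"

definition tensor_space ::
    "('k :: field \<Rightarrow> 'v :: ab_group_add \<Rightarrow> 'v) \<Rightarrow> ('k \<Rightarrow> 'w :: ab_group_add \<Rightarrow> 'w) \<Rightarrow> (('v \<times> 'w) \<Rightarrow>\<^sub>0 'k) set set" where
  "tensor_space s1 s2 = range (tensor_class s1 s2)"

definition pure_tensor ::
    "('k :: field \<Rightarrow> 'v :: ab_group_add \<Rightarrow> 'v) \<Rightarrow> ('k \<Rightarrow> 'w :: ab_group_add \<Rightarrow> 'w) \<Rightarrow>
     'v \<Rightarrow> 'w \<Rightarrow> (('v \<times> 'w) \<Rightarrow>\<^sub>0 'k) set" where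
  "pure_tensor s1 s2 v w = tensor_class s1 s2 (free_pair v w)"

definition tensor_add ::
    "(('v \<times> 'w) \<Rightarrow>\<^sub>0 'k :: field) set \<Rightarrow> (('v \<times> 'w) \<Rightarrow>\<^sub>0 'k) set \<Rightarrow> (('v \<times> 'w) \<Rightarrow>\<^sub>0 'k) set" where
  "tensor_add A B = {a + b | a b. a \<in> A \<and> b \<in> B}"

definition tensor_scale ::
    "('k :: field \<Rightarrow> 'v :: ab_group_add \<Rightarrow> 'v) \<Rightarrow> ('k \<Rightarrow> 'w :: ab_group_add \<Rightarrow> 'w) \<Rightarrow> 'k \<Rightarrow>
     (('v \<times> 'w) \<Rightarrow>\<^sub>0 'k) set \<Rightarrow> (('v \<times> 'w) \<Rightarrow>\<^sub>0 'k) set" where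
  "tensor_scale s1 s2 c A = (\<Union>x \<in> A. tensor_class s1 s2 (free_scale c x))"

definition tensor_map ::
    "('k :: field \<Rightarrow> 'v :: ab_group_add \<Rightarrow> 'v) \<Rightarrow> ('k \<Rightarrow> 'w :: ab_group_add \<Rightarrow> 'w) \<Rightarrow>
     ('v \<Rightarrow> 'v) \<Rightarrow> ('w \<Rightarrow> 'w) \<Rightarrow> (('v \<times> 'w) \<Rightarrow>\<^sub>0 'k) set \<Rightarrow> (('v \<times> 'w) \<Rightarrow>\<^sub>0 'k) set" where
  "tensor_map s1 s2 f g A = (\<Union>x \<in> A. tensor_class s1 s2 (free_map (map_prod f g) x))"

lemma lookup_free_scale [simp]: "Poly_Mapping.lookup (free_scale c x) b = c * Poly_Mapping.lookup x b"
  by (simp add: free_scale_def map.rep_eq when_def)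

interpretation free: vector_space "free_scale :: 'k :: field \<Rightarrow> ('b \<Rightarrow>\<^sub>0 'k) \<Rightarrow> _"
  by unfold_locales (auto intro!: poly_mapping_eqI simp: lookup_add algebra_simps)

lemma free_scale_single: "free_scale c (Poly_Mapping.single b d) = Poly_Mapping.single b (c * d)"
  by (rule poly_mapping_eqI) (simp add: lookup_single when_def)

lemma free_map_alt:
  assumes "finite S" "Poly_Mapping.keys x \<subseteq> S"
  shows "free_map f x = (\<Sum>b \<in> S. Poly_Mapping.single (f b) (Poly_Mapping.lookup x b))"
  unfolding free_map_def using assms
  by (intro sum.mono_neutral_left) (auto simp: in_keys_iff)

lemma free_map_linear:
  "Vector_Spaces.linear (free_scale :: 'k :: field \<Rightarrow> _) free_scale (free_map (f :: 'b \<Rightarrow> 'c))"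
proof unfold_locales
  fix x y :: "'b \<Rightarrow>\<^sub>0 'k" and c :: 'k
  let ?S = "Poly_Mapping.keys x \<union> Poly_Mapping.keys y"
  have S: "finite ?S" "Poly_Mapping.keys (x + y) \<subseteq> ?S" "Poly_Mapping.keys (free_scale c x) \<subseteq> ?S"
    by (auto simp: in_keys_iff lookup_add)
  show "free_map f (x + y) = free_map f x + free_map f y"
    using S by (simp add: free_map_alt[of ?S] lookup_add single_add sum.distrib)
  show "free_map f (free_scale c x) = free_scale c (free_map f x)"
    using S by (simp add: free_map_alt[of ?S] free.scale_sum_right free_scale_single)
qed

lemma free_map_single [simp]: "free_map f (Poly_Mapping.single b c) = Poly_Mapping.single (f b) c"
  by (cases "c = 0") (simp_all add: free_map_def)

lemma tensor_null_subspace: "free.subspace (tensor_null s1 s2)"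
  unfolding tensor_null_def by (rule free.subspace_span)

lemma tensor_class_eq_iff: "tensor_class s1 s2 x = tensor_class s1 s2 y \<longleftrightarrow> x - y \<in> tensor_null s1 s2"
proof
  assume eq: "tensor_class s1 s2 x = tensor_class s1 s2 y"
  have "x \<in> tensor_class s1 s2 x"
    using free.subspace_0[OF tensor_null_subspace] by (simp add: tensor_class_def)
  then show "x - y \<in> tensor_null s1 s2" unfolding eq by (simp add: tensor_class_def)
next
  assume xy: "x - y \<in> tensor_null s1 s2"
  have "z - x \<in> tensor_null s1 s2 \<longleftrightarrow> z - y \<in> tensor_null s1 s2" for z
    using free.subspace_add[OF tensor_null_subspace _ xy, of "z - x"]
      free.subspace_diff[OF tensor_null_subspace _ xy, of "z - y"] by auto
  then show "tensor_class s1 s2 x = tensor_class s1 s2 y" by (simp add: tensor_class_def)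
qed

lemma tensor_class_self: "x \<in> tensor_class s1 s2 x"
  using free.subspace_0[OF tensor_null_subspace] by (simp add: tensor_class_def)

lemma tensor_add_class:
  "tensor_add (tensor_class s1 s2 x) (tensor_class s1 s2 y) = tensor_class s1 s2 (x + y)"
proof (intro subset_antisym subsetI)
  fix z assume "z \<in> tensor_add (tensor_class s1 s2 x) (tensor_class s1 s2 y)"
  then obtain a b where "z = a + b" "a - x \<in> tensor_null s1 s2" "b - y \<in> tensor_null s1 s2"
    by (auto simp: tensor_add_def tensor_class_def)
  then show "z \<in> tensor_class s1 s2 (x + y)"
    using free.subspace_add[OF tensor_null_subspace, of "a - x" s1 s2 "b - y"]
    by (simp add: tensor_class_def algebra_simps)
next
  fix z assume "z \<in> tensor_class s1 s2 (x + y)"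
  then have "z - y \<in> tensor_class s1 s2 x" by (simp add: tensor_class_def algebra_simps)
  then have "(z - y) + y \<in> tensor_add (tensor_class s1 s2 x) (tensor_class s1 s2 y)"
    unfolding tensor_add_def using tensor_class_self by blast
  then show "z \<in> tensor_add (tensor_class s1 s2 x) (tensor_class s1 s2 y)" by simp
qed

lemma tensor_scale_class:
  "tensor_scale s1 s2 c (tensor_class s1 s2 x) = tensor_class s1 s2 (free_scale c x)"
proof -
  have "tensor_class s1 s2 (free_scale c y) = tensor_class s1 s2 (free_scale c x)"
    if "y \<in> tensor_class s1 s2 x" for y
    using that free.subspace_scale[OF tensor_null_subspace, of "y - x" s1 s2 c]
    by (simp add: tensor_class_eq_iff free.scale_right_diff_distrib) (simp add: tensor_class_def)
  then show ?thesis unfolding tensor_scale_def using tensor_class_self by blast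
qed

lemma free_map_tensor_null:
  assumes "Vector_Spaces.linear s1 s1 f" "Vector_Spaces.linear s2 s2 g" "x \<in> tensor_null s1 s2"
  shows "free_map (map_prod f g) x \<in> tensor_null s1 s2"
proof -
  interpret f: Vector_Spaces.linear s1 s1 f by fact
  interpret g: Vector_Spaces.linear s2 s2 g by fact
  interpret m: Vector_Spaces.linear free_scale free_scale "free_map (map_prod f g)"
    by (rule free_map_linear)
  have "x \<in> free.span
     ({free_pair (v + v') w - free_pair v w - free_pair v' w | v v' w. True} \<union>
      {free_pair v (w + w') - free_pair v w - free_pair v w' | v w w'. True} \<union>
      {free_pair (s1 c v) w - free_scale c (free_pair v w) | c v w. True} \<union>
      {free_pair v (s2 c w) - free_scale c (free_pair v w) | c v w. True})" (is "_ \<in> free.span ?R")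
    using assms(3) by (simp only: tensor_null_def)
  then show ?thesis
  proof (induction rule: free.span_induct)
    case base
    show ?case
      using tensor_null_subspace[of s1 s2]
      by (auto simp: free.subspace_def m.add m.scale m.zero)
  next
    case (step x)
    then have "free_map (map_prod f g) x \<in> ?R"
      by (fastforce simp: m.diff m.scale f.add g.add f.scale g.scale)
    then show ?case unfolding tensor_null_def by (rule free.span_base)
  qed
qed

lemma tensor_map_class:
  assumes "Vector_Spaces.linear s1 s1 f" "Vector_Spaces.linear s2 s2 g"
  shows "tensor_map s1 s2 f g (tensor_class s1 s2 x) = tensor_class s1 s2 (free_map (map_prod f g) x)"
proof -
  interpret m: Vector_Spaces.linear free_scale free_scale "free_map (map_prod f g)"
    by (rule free_map_linear)
  have "tensor_class s1 s2 (free_map (map_prod f g) y) = tensor_class s1 s2 (free_map (map_prod f g) x)"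
    if "y \<in> tensor_class s1 s2 x" for y
    using that free_map_tensor_null[OF assms, of "y - x"]
    by (simp add: tensor_class_eq_iff m.diff) (simp add: tensor_class_def)
  then show ?thesis unfolding tensor_map_def using tensor_class_self by blast
qed

lemma tensor_map_pure:
  assumes "Vector_Spaces.linear s1 s1 f" "Vector_Spaces.linear s2 s2 g"
  shows "tensor_map s1 s2 f g (pure_tensor s1 s2 v w) = pure_tensor s1 s2 (f v) (g w)"
  using tensor_map_class[OF assms] by (simp add: pure_tensor_def)

text \<open>Linear forms are normalised to be zero off the carrier, so that they form a subspace of
  the space of all functions with pointwise operations \<open>fun_scale\<close>.\<close>

definition tensor_dual ::
    "('k :: field \<Rightarrow> 'v :: ab_group_add \<Rightarrow> 'v) \<Rightarrow> ('k \<Rightarrow> 'w :: ab_group_add \<Rightarrow> 'w) \<Rightarrow>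
     ((('v \<times> 'w) \<Rightarrow>\<^sub>0 'k) set \<Rightarrow> 'k) set" where
  "tensor_dual s1 s2 = {l.
     (\<forall>A \<in> tensor_space s1 s2. \<forall>B \<in> tensor_space s1 s2. l (tensor_add A B) = l A + l B) \<and>
     (\<forall>c. \<forall>A \<in> tensor_space s1 s2. l (tensor_scale s1 s2 c A) = c * l A) \<and>
     (\<forall>A. A \<notin> tensor_space s1 s2 \<longrightarrow> l A = 0)}"

definition fun_scale :: "'k :: field \<Rightarrow> ('b \<Rightarrow> 'k) \<Rightarrow> 'b \<Rightarrow> 'k" where
  "fun_scale c l = (\<lambda>x. c * l x)"

lemma vector_space_fun_scale: "vector_space (fun_scale :: 'k :: field \<Rightarrow> ('b \<Rightarrow> 'k) \<Rightarrow> _)"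
  by unfold_locales (auto simp: fun_scale_def fun_eq_iff algebra_simps)

text \<open>Linear forms on the tensor product are the same as bilinear forms.\<close>

lemma tensor_universal:
  fixes s1 :: "'k :: field \<Rightarrow> 'v :: ab_group_add \<Rightarrow> 'v" and s2 :: "'k \<Rightarrow> 'w :: ab_group_add \<Rightarrow> 'w"
  assumes "vector_space s1" "vector_space s2"
    and "\<And>w. Vector_Spaces.linear s1 (*) (\<lambda>v. \<beta> v w)"
    and "\<And>v. Vector_Spaces.linear s2 (*) (\<beta> v)"
  shows "\<exists>!l. l \<in> tensor_dual s1 s2 \<and> (\<forall>v w. l (pure_tensor s1 s2 v w) = \<beta> v w)"
proof (rule ex_ex1I)
  interpret b1: Vector_Spaces.linear s1 "(*)" "\<lambda>v. \<beta> v w" for w by (rule assms)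
  interpret b2: Vector_Spaces.linear s2 "(*)" "\<beta> v" for v by (rule assms)
  define h where "h x = (\<Sum>b \<in> Poly_Mapping.keys x. Poly_Mapping.lookup x b * case_prod \<beta> b)"
    for x :: "('v \<times> 'w) \<Rightarrow>\<^sub>0 'k"
  have h_alt: "h x = (\<Sum>b \<in> S. Poly_Mapping.lookup x b * case_prod \<beta> b)"
    if "finite S" "Poly_Mapping.keys x \<subseteq> S" for x S
    unfolding h_def using that by (intro sum.mono_neutral_left) (auto simp: in_keys_iff)
  have h_add: "h (x + y) = h x + h y" for x y
  proof -
    let ?S = "Poly_Mapping.keys x \<union> Poly_Mapping.keys y"
    have "finite ?S" "Poly_Mapping.keys (x + y) \<subseteq> ?S" by (auto simp: in_keys_iff lookup_add)
    then show ?thesis by (simp add: h_alt[of ?S] lookup_add sum.distrib distrib_right)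
  qed
  have h_scale: "h (free_scale c x) = c * h x" for c x
    by (subst h_alt[of "Poly_Mapping.keys x"])
      (auto simp: in_keys_iff h_def sum_distrib_left ac_simps)
  have h_single: "h (free_pair v w) = \<beta> v w" for v w by (simp add: h_def)
  have h_diff: "h (x - y) = h x - h y" for x y using h_add[of "x - y" y] by simp
  have h0: "h 0 = 0" by (simp add: h_def)
  have h_null: "h x = 0" if "x \<in> tensor_null s1 s2" for x
    using that unfolding tensor_null_def
  proof (induction rule: free.span_induct)
    case base
    show ?case by (auto simp: free.subspace_def h_add h_scale h0)
  next
    case (step x)
    then show ?case
      by (auto simp: h_diff h_single h_scale b1.add b2.add b1.scale b2.scale)
  qed
  define l where "l A = (if A \<in> tensor_space s1 s2 then h (SOME x. x \<in> A) else 0)" for A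
  have l: "l (tensor_class s1 s2 x) = h x" for x
  proof -
    have "(SOME y. y \<in> tensor_class s1 s2 x) \<in> tensor_class s1 s2 x"
      using tensor_class_self by (rule someI)
    then have "h ((SOME y. y \<in> tensor_class s1 s2 x) - x) = 0"
      by (intro h_null) (simp add: tensor_class_def)
    then show ?thesis by (simp add: l_def tensor_space_def h_diff)
  qed
  have "l \<in> tensor_dual s1 s2"
    unfolding tensor_dual_def
    by (auto simp: tensor_space_def tensor_add_class tensor_scale_class l h_add h_scale)
      (simp add: l_def tensor_space_def)
  then show "\<exists>l. l \<in> tensor_dual s1 s2 \<and> (\<forall>v w. l (pure_tensor s1 s2 v w) = \<beta> v w)"
    by (intro exI[of _ l]) (simp add: pure_tensor_def l h_single)
next
  fix l l'
  assume l: "l \<in> tensor_dual s1 s2 \<and> (\<forall>v w. l (pure_tensor s1 s2 v w) = \<beta> v w)"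
    and l': "l' \<in> tensor_dual s1 s2 \<and> (\<forall>v w. l' (pure_tensor s1 s2 v w) = \<beta> v w)"
  let ?c = "tensor_class s1 s2"
  have lin: "m (?c (x + y)) = m (?c x) + m (?c y)" "m (?c (free_scale c x)) = c * m (?c x)"
    if "m \<in> tensor_dual s1 s2" for m x y c
    using that by (auto simp: tensor_dual_def tensor_space_def simp flip: tensor_add_class tensor_scale_class)
  have "m (?c 0) = 0" if "m \<in> tensor_dual s1 s2" for m
    using lin(2)[OF that, of 0 0] by simp
  then have "l (?c 0) = l' (?c 0)" using l l' by metis
  moreover have "l (?c (Poly_Mapping.single b c)) = l' (?c (Poly_Mapping.single b c))" for b c
  proof -
    obtain v w where b: "b = (v, w)" by (cases b)
    have "Poly_Mapping.single b c = free_scale c (free_pair v w)" by (simp add: free_scale_single b)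
    then show ?thesis using l l' lin(2)[of l c "free_pair v w"] lin(2)[of l' c "free_pair v w"]
      by (simp add: pure_tensor_def)
  qed
  ultimately have "l (?c (\<Sum>b\<in>S. Poly_Mapping.single b (f b))) = l' (?c (\<Sum>b\<in>S. Poly_Mapping.single b (f b)))"
    for S f using l l' by (induction S rule: infinite_finite_induct) (simp_all add: lin(1)[of l] lin(1)[of l'])
  moreover have "x = (\<Sum>b\<in>Poly_Mapping.keys x. Poly_Mapping.single b (Poly_Mapping.lookup x b))"
    for x :: "('v \<times> 'w) \<Rightarrow>\<^sub>0 'k"
    by (rule poly_mapping_eqI)
      (auto simp: lookup_sum lookup_single when_def sum.delta in_keys_iff)
  ultimately have "l (?c x) = l' (?c x)" for x by metis
  then have "l A = l' A" for A
    using l l' by (cases "A \<in> tensor_space s1 s2") (auto simp: tensor_space_def tensor_dual_def)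
  then show "l = l'" by blast
qed

definition Hom_P ::
    "('k :: field \<Rightarrow> 'v :: ab_group_add \<Rightarrow> 'v) \<Rightarrow> ('p :: prime_card padic ^ 2 ^ 2 \<Rightarrow> 'v \<Rightarrow> 'v) \<Rightarrow>
     ('k \<Rightarrow> 'w :: ab_group_add \<Rightarrow> 'w) \<Rightarrow> ('p padic ^ 2 ^ 2 \<Rightarrow> 'w \<Rightarrow> 'w) \<Rightarrow>
     ((('v \<times> 'w) \<Rightarrow>\<^sub>0 'k) set \<Rightarrow> 'k) set" where
  "Hom_P s1 \<rho>1 s2 \<rho>2 = {l \<in> tensor_dual s1 s2.
     \<forall>x \<in> mirabolic. \<forall>A \<in> tensor_space s1 s2.
       l (tensor_map s1 s2 (\<rho>1 x) (\<rho>2 x) A) = delta_P x * l A}"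

lemma Hom_P_subspace: "module.subspace fun_scale (Hom_P s1 \<rho>1 s2 \<rho>2)"
proof -
  interpret vector_space "fun_scale :: 'a \<Rightarrow> _" by (rule vector_space_fun_scale)
  have closed: "tensor_add A B \<in> tensor_space s1 s2" "tensor_scale s1 s2 c A \<in> tensor_space s1 s2"
    if "A \<in> tensor_space s1 s2" "B \<in> tensor_space s1 s2" for A B c
    using that by (auto simp: tensor_space_def tensor_add_class tensor_scale_class)
  show ?thesis
    by (auto simp: subspace_def Hom_P_def tensor_dual_def fun_scale_def closed algebra_simps)
qed

end

theory Submission
  imports Defs
begin

unbundle no Formal_Power_Series.fps_syntax

text \<open>
  Let \<open>W1\<close>, \<open>W2\<close> be spherical vectors and \<open>\<beta>\<close> an equivariant bilinear form.  By the Iwasawa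
  decomposition the translates of \<open>W1\<close> and \<open>W2\<close> by the mirabolic group \<open>P\<close>, which are indexed by
  the vertices of the Bruhat-Tits tree, span the representations, so \<open>\<beta>\<close> is determined by its
  values on pairs of vertices.  Up to \<open>P\<close>, a pair of vertices is given by its distances \<open>i\<close>, \<open>j\<close> to
  the vertex where their rays towards the end fixed by \<open>P\<close> meet; let \<open>F i j\<close> be the value on such a
  pair.  Since \<open>W1\<close> and \<open>W2\<close> are Hecke eigenvectors, with eigenvalues \<open>t1\<close>, \<open>t2\<close> say,
    \<open>p F(1,0) + p \<omega>1 F(0,1) = t1 F(0,0)\<close> and \<open>p \<omega>2 F(1,0) + p F(0,1) = t2 F(0,0)\<close>,
  and as \<open>\<omega>1 \<omega>2 \<noteq> 1\<close> this determines \<open>F(1,0)\<close> and \<open>F(0,1)\<close>.  The Hecke relations at the other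
  pairs then determine all values \<open>F(0,j)\<close>, next \<open>F(1,j)\<close> after dividing by \<open>p - 1\<close>, and finally all
  \<open>F(i,j)\<close>.  Hence \<open>\<beta>\<close> is determined by \<open>F(0,0)\<close>, its value on \<open>(W1, W2)\<close>.
\<close>

section \<open>Integral p-adic numbers and residues\<close>

lemma Zp_units_subset: "u \<in> Zp_units \<Longrightarrow> u \<in> Zp"
  by (simp add: Zp_units_def)

lemma Zp_units_nonzero: "u \<in> Zp_units \<Longrightarrow> u \<noteq> 0"
  by (auto simp: Zp_units_def)

lemma Zp_0 [simp]: "0 \<in> Zp" and Zp_1 [simp]: "1 \<in> Zp"
  unfolding Zp_def by (metis of_padic_int_simps(1) rangeI, metis of_padic_int_simps(2) rangeI)

lemma of_padic_int_diff [simp]: "of_padic_int (x - y) = of_padic_int x - of_padic_int y"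
  using of_padic_int_simps(3)[of "x - y" y] by (simp add: eq_diff_eq)

lemma Zp_add [intro]: "x \<in> Zp \<Longrightarrow> y \<in> Zp \<Longrightarrow> x + y \<in> Zp"
  and Zp_mult [intro]: "x \<in> Zp \<Longrightarrow> y \<in> Zp \<Longrightarrow> x * y \<in> Zp"
  and Zp_diff [intro]: "x \<in> Zp \<Longrightarrow> y \<in> Zp \<Longrightarrow> x - y \<in> Zp"
  unfolding Zp_def by (auto simp flip: of_padic_int_simps of_padic_int_diff)

lemma Zp_minus [intro]: "x \<in> Zp \<Longrightarrow> - x \<in> Zp"
  using Zp_diff[of 0 x] by simp

lemma Zp_power [intro]: "x \<in> Zp \<Longrightarrow> x ^ n \<in> Zp"
  by (induction n) auto

lemma Zp_of_nat [simp]: "of_nat n \<in> Zp"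
  by (induction n) auto

lemma Zp_units_1 [simp]: "1 \<in> Zp_units"
  by (auto simp: Zp_units_def)

lemma Zp_units_mult: "u \<in> Zp_units \<Longrightarrow> v \<in> Zp_units \<Longrightarrow> u * v \<in> Zp_units"
  using Zp_units_divide[of u "inverse v"] Zp_units_divide[of 1 v] by (simp add: divide_inverse)

lemma Zp_units_inverse: "u \<in> Zp_units \<Longrightarrow> inverse u \<in> Zp_units"
  using Zp_units_divide[of 1 u] by (simp add: divide_inverse)

lemma Zp_units_minus_1: "- 1 \<in> Zp_units"
proof -
  have "- 1 \<in> (Zp :: 'a padic set)" by (intro Zp_minus Zp_1)
  then show ?thesis unfolding Zp_units_def by (auto intro!: bexI[of _ "- 1"])
qed

lemma Zp_units_minus: "u \<in> Zp_units \<Longrightarrow> - u \<in> Zp_units"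
  using Zp_units_divide[of u "- 1"] by (simp add: Zp_units_minus_1)

text \<open>Writing a nonzero element as a power of p times a unit, the exponents 0 and > 0 give the
  two cases. This is the local ring property, stated as a case rule.\<close>

lemma Zp_unit_or_divisible:
  assumes "z \<in> Zp"
  obtains "z \<in> Zp_units" | y where "y \<in> Zp" "z = padic_p * y"
proof (cases "z = 0")
  case True
  then show ?thesis by (intro that(2)[of 0]) simp_all
next
  case False
  obtain x where x: "z = of_padic_int x" using assms by (auto simp: Zp_def)
  with False have "x \<noteq> 0" by auto
  then obtain n u where u: "u dvd 1" "x = of_nat CARD('a) ^ n * u" by (rule padic_int_decomp)
  show ?thesis
  proof (cases n)
    case 0
    then have "z \<in> Zp_units" using u x Zp_units_of_padic_int by simp
    then show ?thesis by (rule that(1))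
  next
    case (Suc m)
    then have "z = padic_p * of_padic_int (of_nat CARD('a) ^ m * u)" by (simp add: x u)
    moreover have "of_padic_int (of_nat CARD('a) ^ m * u) \<in> Zp" unfolding Zp_def by (rule rangeI)
    ultimately show ?thesis by (intro that(2))
  qed
qed

lemma p_multiple_not_unit:
  assumes "z \<in> Zp"
  shows "padic_p * z \<notin> Zp_units"
proof
  assume "padic_p * z \<in> Zp_units"
  then obtain a b where ab: "padic_p * z = of_padic_int a" "a * b = 1" by (rule Zp_unitsE)
  obtain y where "z = of_padic_int y" using assms by (auto simp: Zp_def)
  then have "of_padic_int a = of_padic_int (of_nat CARD('a) * y)" using ab by simp
  then have "a = of_nat CARD('a) * y" by (simp only: of_padic_int_eq_iff)
  then have "of_nat CARD('a) * (y * b) = (1 :: 'a padic_int)" using ab by (simp add: mult.assoc)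
  then show False using padic_int_p_not_unit by (metis dvd_triv_left)
qed

lemma Zp_unit_add_multiple:
  assumes "u \<in> Zp_units" "z \<in> Zp"
  shows "u + padic_p * z \<in> Zp_units"
proof -
  have "u + padic_p * z \<in> Zp"
    using assms by (intro Zp_add Zp_mult Zp_of_nat) (auto dest: Zp_units_subset)
  then show ?thesis
  proof (cases rule: Zp_unit_or_divisible)
    case (2 y)
    then have "u = padic_p * (y - z)" by (simp add: algebra_simps)
    then show ?thesis using assms p_multiple_not_unit[of "y - z"] 2 by auto
  qed
qed

lemma one_minus_p_power_unit:
  assumes "z \<in> Zp"
  shows "1 - padic_p ^ Suc i * z \<in> Zp_units"
proof -
  have "1 + padic_p * - (padic_p ^ i * z) \<in> Zp_units"
    using assms by (intro Zp_unit_add_multiple Zp_minus Zp_mult Zp_power Zp_units_1 Zp_of_nat)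
  then show ?thesis by (simp add: mult.assoc)
qed

lemma padic_decomp:
  assumes "x \<noteq> 0"
  obtains n u where "u \<in> Zp_units" "x = padic_p powi n * u"
  using padic_val_ex1[OF assms] by blast

lemma Zp_decomp:
  assumes "z \<in> Zp" "z \<noteq> 0"
  obtains n u where "u \<in> Zp_units" "z = padic_p ^ n * u"
proof -
  obtain x where x: "z = of_padic_int x" using assms by (auto simp: Zp_def)
  with assms have "x \<noteq> 0" by auto
  then obtain n u where "u dvd 1" "x = of_nat CARD('a) ^ n * u" by (rule padic_int_decomp)
  then show thesis using that[of "of_padic_int u" n] by (simp add: x Zp_units_of_padic_int)
qed

text \<open>Compare valuations. The rule decides which entry of the bottom row to clear in the
  Iwasawa decomposition, and which of \<open>a\<close>, \<open>a'\<close>, \<open>b' - b\<close> to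
  scale to 1 when a pair of vertices is normalised.\<close>

lemma Zp_dichotomy:
  fixes x y :: "'p :: prime_card padic"
  obtains "y \<noteq> 0" "x / y \<in> Zp" | "x \<noteq> 0" "y / x \<in> Zp" | "x = 0" "y = 0"
proof (cases "x = 0 \<or> y = 0")
  case True
  then consider "x = 0" "y = 0" | "x = 0" "y \<noteq> 0" | "x \<noteq> 0" "y = 0" by blast
  then show ?thesis
  proof cases
    case 1
    then show ?thesis by (rule that(3))
  next
    case 2
    then show ?thesis by (intro that(1)) simp_all
  next
    case 3
    then show ?thesis by (intro that(2)) simp_all
  qed
next
  case False
  have *: "padic_p powi m * u / (padic_p powi n * v) \<in> Zp"
    if "u \<in> Zp_units" "v \<in> Zp_units" "n \<le> m" for u v :: "'p padic" and m n
  proof -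
    obtain k where "m = n + int k" using \<open>n \<le> m\<close> zle_iff_zadd by auto
    then have "padic_p powi m * u / (padic_p powi n * v) = padic_p ^ k * (u / v)"
      using padic_p_nonzero[where 'p='p] by (simp add: power_int_add)
    moreover have "padic_p ^ k * (u / v) \<in> Zp"
      using Zp_units_subset[OF Zp_units_divide[OF that(1,2)]] by (intro Zp_mult Zp_power Zp_of_nat)
    ultimately show ?thesis by simp
  qed
  from False have "x \<noteq> 0" "y \<noteq> 0" by simp_all
  obtain m u where m: "u \<in> Zp_units" "x = padic_p powi m * u"
    using \<open>x \<noteq> 0\<close> by (rule padic_decomp)
  obtain n v where n: "v \<in> Zp_units" "y = padic_p powi n * v"
    using \<open>y \<noteq> 0\<close> by (rule padic_decomp)
  show ?thesis
  proof (cases "n \<le> m")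
    case True
    then have "x / y \<in> Zp" using * m n by simp
    then show ?thesis by (rule that(1)[OF \<open>y \<noteq> 0\<close>])
  next
    case False
    then have "y / x \<in> Zp" using * m n by simp
    then show ?thesis by (rule that(2)[OF \<open>x \<noteq> 0\<close>])
  qed
qed

section \<open>Residues modulo p\<close>

lemma nat_diff_unit:
  assumes "c < CARD('p)" "c' < CARD('p)" "c \<noteq> c'"
  shows "of_nat c - of_nat c' \<in> (Zp_units :: 'p :: prime_card padic set)"
proof -
  have "(int c - int c') mod int CARD('p) \<noteq> 0"
  proof
    assume "(int c - int c') mod int CARD('p) = 0"
    then have "int c mod int CARD('p) = int c' mod int CARD('p)"
      by (simp add: mod_eq_dvd_iff dvd_eq_mod_eq_0)
    then show False using assms by simp
  qed
  then have "padic_residue (of_nat c - of_nat c' :: 'p padic_int) 1 \<noteq> 0"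
    by (simp add: minus_padic_int.rep_eq padic_residue_of_nat mod_diff_eq)
  then have "of_padic_int (of_nat c - of_nat c' :: 'p padic_int) \<in> Zp_units"
    by (intro Zp_units_of_padic_int padic_int_unit)
  then show ?thesis by simp
qed

lemma nat_unit:
  assumes "0 < c" "c < CARD('p)"
  shows "of_nat c \<in> (Zp_units :: 'p :: prime_card padic set)"
  using nat_diff_unit[of c 0] assms by auto

text \<open>The digit is the residue at level 1. Subtracting it leaves an element whose residue
  there is 0; such an element cannot be a unit, so p divides it.\<close>

lemma residue_ex:
  assumes "z \<in> (Zp :: 'p :: prime_card padic set)"
  shows "\<exists>c < CARD('p). \<exists>y \<in> Zp. z = of_nat c + padic_p * y"
proof -
  obtain x where x: "z = of_padic_int x" using assms by (auto simp: Zp_def)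
  define c where "c = nat (padic_residue x 1)"
  have c: "int c = padic_residue x 1" "c < CARD('p)"
    using padic_residue_bounds[of x 1] by (auto simp: c_def)
  have res: "padic_residue (x - of_nat c) 1 = 0"
    using c by (simp add: minus_padic_int.rep_eq padic_residue_of_nat)
  have "z - of_nat c \<in> Zp" using assms by auto
  then show ?thesis
  proof (cases rule: Zp_unit_or_divisible)
    case 1
    have "of_padic_int (x - of_nat c) = z - of_nat c" by (simp add: x)
    moreover obtain a b where ab: "z - of_nat c = of_padic_int a" "a * b = 1"
      using 1 by (rule Zp_unitsE)
    ultimately have "of_padic_int a = of_padic_int (x - of_nat c)" by simp
    then have "a = x - of_nat c" by (simp only: of_padic_int_eq_iff)
    then have "padic_residue (a * b) 1 = 0" using res by (simp add: times_padic_int.rep_eq)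
    then show ?thesis using ab prime_gt_1_int[OF prime_card_int[where 'a='p]]
      by (simp add: one_padic_int.rep_eq)
  next
    case (2 y)
    then have "z = of_nat c + padic_p * y" by (simp add: algebra_simps)
    then show ?thesis using 2 c by blast
  qed
qed

text \<open>The function \<open>h\<close> depends only on the class modulo p, and the
  \<open>\<sigma> c\<close> are p pairwise incongruent elements, hence a full system of
  representatives. Generators of GL2(Z_p) permute the terms of the Hecke sum in this way.\<close>

lemma sum_residues:
  fixes h :: "'p :: prime_card padic \<Rightarrow> 'v :: comm_monoid_add"
  assumes h: "\<And>x z. x \<in> Zp \<Longrightarrow> z \<in> Zp \<Longrightarrow> h (x + padic_p * z) = h x"
    and \<sigma>: "\<And>c. c < CARD('p) \<Longrightarrow> \<sigma> c \<in> Zp"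
    and inj: "\<And>c c'. c < CARD('p) \<Longrightarrow> c' < CARD('p) \<Longrightarrow> c \<noteq> c' \<Longrightarrow> \<sigma> c - \<sigma> c' \<in> Zp_units"
  shows "(\<Sum>c<CARD('p). h (\<sigma> c)) = (\<Sum>c<CARD('p). h (of_nat c))"
proof -
  have "\<forall>c \<in> {..<CARD('p)}. \<exists>d. d < CARD('p) \<and> (\<exists>y \<in> Zp. \<sigma> c = of_nat d + padic_p * y)"
    using residue_ex[OF \<sigma>] by simp
  from bchoice[OF this] obtain \<tau> where \<tau>: "c < CARD('p) \<Longrightarrow> \<tau> c < CARD('p)"
      "c < CARD('p) \<Longrightarrow> \<exists>y \<in> Zp. \<sigma> c = of_nat (\<tau> c) + padic_p * y" for c
    by auto
  have "inj_on \<tau> {..<CARD('p)}"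
  proof (rule inj_onI, rule ccontr)
    fix c c' assume c: "c \<in> {..<CARD('p)}" "c' \<in> {..<CARD('p)}" "\<tau> c = \<tau> c'" "c \<noteq> c'"
    then obtain y y' where "y \<in> Zp" "y' \<in> Zp" "\<sigma> c = of_nat (\<tau> c) + padic_p * y"
      "\<sigma> c' = of_nat (\<tau> c) + padic_p * y'"
      using \<tau>(2)[of c] \<tau>(2)[of c'] by auto
    then have "\<sigma> c - \<sigma> c' = padic_p * (y - y')" "y - y' \<in> Zp" by (auto simp: algebra_simps)
    then show False using inj[of c c'] c p_multiple_not_unit by auto
  qed
  moreover have "\<tau> ` {..<CARD('p)} \<subseteq> {..<CARD('p)}" using \<tau> by auto
  ultimately have "bij_betw \<tau> {..<CARD('p)} {..<CARD('p)}"
    by (simp add: bij_betw_def endo_inj_surj)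
  then have "(\<Sum>c<CARD('p). h (of_nat c)) = (\<Sum>c<CARD('p). h (of_nat (\<tau> c)))"
    by (rule sum.reindex_bij_betw[symmetric])
  also have "\<dots> = (\<Sum>c<CARD('p). h (\<sigma> c))"
  proof (rule sum.cong[OF refl])
    fix c assume "c \<in> {..<CARD('p)}"
    then obtain y where "y \<in> Zp" "\<sigma> c = of_nat (\<tau> c) + padic_p * y" using \<tau>(2)[of c] by auto
    then show "h (of_nat (\<tau> c)) = h (\<sigma> c)" using h[of "of_nat (\<tau> c)" y] by simp
  qed
  finally show ?thesis by simp
qed

section \<open>Matrices\<close>

definition mtx :: "'a \<Rightarrow> 'a \<Rightarrow> 'a \<Rightarrow> 'a \<Rightarrow> 'a :: zero ^ 2 ^ 2" where
  "mtx a b c d = vector [vector [a, b], vector [c, d]]"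

lemma mtx_nth [simp]:
  "mtx a b c d $ 1 $ 1 = a" "mtx a b c d $ 1 $ 2 = b"
  "mtx a b c d $ 2 $ 1 = c" "mtx a b c d $ 2 $ 2 = d"
  by (simp_all add: mtx_def)

lemma mtx_eta: "A = mtx (A $ 1 $ 1) (A $ 1 $ 2) (A $ 2 $ 1) (A $ 2 $ 2)"
  by (simp add: vec_eq_iff forall_2)

lemma mtx_cases: obtains a b c d where "A = mtx a b c d"
  using mtx_eta by blast

lemma mtx_mult: "mtx a b c d ** mtx a' b' c' d'
    = mtx (a * a' + b * c') (a * b' + b * d') (c * a' + d * c') (c * b' + d * d' :: 'a :: semiring_1)"
  by (simp add: vec_eq_iff forall_2 matrix_matrix_mult_def sum_2)

lemma mat_mtx: "mat z = mtx z 0 0 z"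
  by (simp add: vec_eq_iff forall_2 mat_def)

lemma mtx_eq_iff: "mtx a b c d = mtx a' b' c' d' \<longleftrightarrow> a = a' \<and> b = b' \<and> c = c' \<and> d = d'"
  by (auto simp: vec_eq_iff forall_2)

lemma mtx_inverse:
  assumes "a * d - b * c \<noteq> (0 :: 'a :: field)"
  defines "e \<equiv> inverse (a * d - b * c)"
  shows "mtx a b c d ** mtx (d * e) (- b * e) (- c * e) (a * e) = mat 1"
    and "mtx (d * e) (- b * e) (- c * e) (a * e) ** mtx a b c d = mat 1"
proof -
  have "(a * d - b * c) * e = 1" using assms by simp
  then have e: "a * (d * e) - b * (c * e) = 1" by (simp add: left_diff_distrib mult.assoc)
  have "a * (d * e) + b * (- c * e) = 1" "a * (- b * e) + b * (a * e) = 0"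
    "c * (d * e) + d * (- c * e) = 0" "c * (- b * e) + d * (a * e) = 1"
    "d * e * a + - b * e * c = 1" "d * e * b + - b * e * d = 0"
    "- c * e * a + a * e * c = 0" "- c * e * b + a * e * d = 1"
    using e by (simp_all add: ac_simps)
  then show "mtx a b c d ** mtx (d * e) (- b * e) (- c * e) (a * e) = mat 1"
    and "mtx (d * e) (- b * e) (- c * e) (a * e) ** mtx a b c d = mat 1"
    by (simp_all only: mtx_mult mat_mtx)
qed

lemma mtx_GL2_Qp_iff: "mtx a b c d \<in> GL2_Qp \<longleftrightarrow> a * d - b * c \<noteq> 0"
  by (simp add: GL2_Qp_def invertible_det_nz det_2)

text \<open>One direction is multiplicativity of the determinant; the other is the adjugate formula
  \<open>mtx_inverse\<close>, whose entries are integral once the determinant is a unit.\<close>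

lemma mtx_GL2_Zp_iff:
  "mtx a b c d \<in> GL2_Zp \<longleftrightarrow> a \<in> Zp \<and> b \<in> Zp \<and> c \<in> Zp \<and> d \<in> Zp \<and> a * d - b * c \<in> Zp_units"
  (is "?A \<in> _ \<longleftrightarrow> ?R")
proof
  assume K: "?A \<in> GL2_Zp"
  then have A: "?A $ i $ j \<in> Zp" for i j unfolding GL2_Zp_def mem_Collect_eq by blast
  from K obtain B where B: "\<forall>i j. B $ i $ j \<in> Zp" "?A ** B = mat 1"
    unfolding GL2_Zp_def mem_Collect_eq by (elim conjE exE)
  have A: "a \<in> Zp" "b \<in> Zp" "c \<in> Zp" "d \<in> Zp"
    using A[of 1 1] A[of 1 2] A[of 2 1] A[of 2 2] by simp_all
  have "det ?A * det B = 1" using B(2) by (metis det_I det_mul)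
  moreover have "det B \<in> Zp" using B(1) unfolding det_2 by (intro Zp_diff Zp_mult) blast+
  moreover have d: "det ?A = a * d - b * c" by (simp add: det_2)
  moreover have "a * d - b * c \<in> Zp" using A by (intro Zp_diff Zp_mult)
  ultimately have "a * d - b * c \<in> Zp_units" unfolding Zp_units_def by auto
  then show ?R using A by blast
next
  assume R: ?R
  define e where "e = inverse (a * d - b * c)"
  have e: "e \<in> Zp" using R Zp_units_inverse Zp_units_subset by (auto simp: e_def)
  have "a * d - b * c \<noteq> 0" using R Zp_units_nonzero by blast
  note inv = mtx_inverse[OF this, folded e_def]
  have "\<forall>i j. mtx (d * e) (- b * e) (- c * e) (a * e) $ i $ j \<in> Zp"
    using R e by (auto simp: forall_2 intro!: Zp_mult Zp_minus)
  moreover have "\<forall>i j. ?A $ i $ j \<in> Zp" using R by (simp add: forall_2)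
  ultimately show "?A \<in> GL2_Zp" unfolding GL2_Zp_def using inv by blast
qed

lemma GL2_Zp_subset: "g \<in> GL2_Zp \<Longrightarrow> g \<in> GL2_Qp"
  by (cases g rule: mtx_cases) (auto simp: mtx_GL2_Qp_iff mtx_GL2_Zp_iff dest: Zp_units_nonzero)

lemma mtx_mirabolic: "a \<noteq> 0 \<Longrightarrow> mtx a b 0 1 \<in> mirabolic"
  by (auto simp: mirabolic_def mtx_def)

lemma delta_P_mtx:
  fixes u :: "'p :: prime_card padic"
  assumes "u \<in> Zp_units"
  shows "delta_P (mtx (padic_p powi n * u) b c d) = (of_nat CARD('p) powi (- n) :: 'k :: field)"
proof -
  have "padic_p powi n * u \<noteq> 0" 
    using Zp_units_nonzero[OF assms] padic_p_nonzero[where 'p='p] by simp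
  then have "padic_val (padic_p powi n * u) = n"
    unfolding padic_val_def by (intro the1_equality padic_val_ex1) (use assms in blast)+
  then show ?thesis by (simp add: delta_P_def)
qed

lemma delta_P_nonzero:
  fixes x :: "'p :: prime_card padic"
  assumes "of_nat CARD('p) \<noteq> (0 :: 'k :: field)" "x \<noteq> 0"
  shows "delta_P (mtx x b c d) \<noteq> (0 :: 'k)"
proof -
  obtain n u where "u \<in> Zp_units" "x = padic_p powi n * u" using assms(2) by (rule padic_decomp)
  then show ?thesis using assms(1) by (simp add: delta_P_mtx)
qed

section \<open>The Hecke relation\<close>

locale spherical_vector =
  fixes s :: "'k :: field \<Rightarrow> 'v :: ab_group_add \<Rightarrow> 'v"
    and \<rho> :: "'p :: prime_card padic ^ 2 ^ 2 \<Rightarrow> 'v \<Rightarrow> 'v"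
    and W :: 'v
  assumes rep: "GL2_representation s \<rho>" and nondeg: "nondegenerate s \<rho>"
    and sph: "W \<in> spherical \<rho>" and W_nonzero: "W \<noteq> 0"
begin

sublocale vector_space s
  using rep by (simp add: GL2_representation_def)

lemma linear_act: "g \<in> GL2_Qp \<Longrightarrow> Vector_Spaces.linear s s (\<rho> g)"
  using rep by (simp add: GL2_representation_def)

lemma act_mult: "g \<in> GL2_Qp \<Longrightarrow> h \<in> GL2_Qp \<Longrightarrow> \<rho> (g ** h) v = \<rho> g (\<rho> h v)"
  using rep by (simp add: GL2_representation_def)

lemma act_add: "g \<in> GL2_Qp \<Longrightarrow> \<rho> g (v + w) = \<rho> g v + \<rho> g w"
  by (rule module_hom.add[OF Vector_Spaces.linear.axioms(3)[OF linear_act]])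

lemma act_scale: "g \<in> GL2_Qp \<Longrightarrow> \<rho> g (s c v) = s c (\<rho> g v)"
  by (rule module_hom.scale[OF Vector_Spaces.linear.axioms(3)[OF linear_act]])

lemma act_sum:
  assumes "g \<in> GL2_Qp"
  shows "\<rho> g (sum f A) = (\<Sum>x\<in>A. \<rho> g (f x))"
proof -
  interpret Vector_Spaces.linear s s "\<rho> g" using assms by (rule linear_act)
  show ?thesis by (rule sum)
qed

lemma act_integral:
  assumes "g \<in> GL2_Qp" "k \<in> GL2_Zp"
  shows "\<rho> (g ** k) W = \<rho> g W"
  using assms sph act_mult[OF assms(1) GL2_Zp_subset] by (simp add: spherical_def)

lemma spherical_multiple:
  assumes "v \<in> spherical \<rho>"
  obtains c where "v = s c W"
proof -
  have "dim (spherical \<rho>) = 1" using nondeg by (simp add: nondegenerate_def)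
  then obtain B where B: "B \<subseteq> spherical \<rho>" "spherical \<rho> \<subseteq> span B" "card B = 1"
    using basis_exists[of "spherical \<rho>"] by metis
  then obtain w where w: "B = {w}" by (auto simp: card_1_singleton_iff)
  obtain a where a: "W = s a w" using sph B w by (auto simp: span_singleton)
  then have "a \<noteq> 0" using W_nonzero by auto
  obtain b where "v = s b w" using assms B w by (auto simp: span_singleton)
  then have "v = s (b / a) W" using a \<open>a \<noteq> 0\<close> by simp
  then show thesis by (rule that)
qed

lemma central_character: "z \<noteq> 0 \<Longrightarrow> \<rho> (mat z) v = s (central_character s \<rho> z) v"
  using theI'[OF central_character_ex1[OF rep nondeg], of z] unfolding central_character_def by blast

text \<open>By \<open>E_unit\<close> and \<open>E_shift\<close> below, the vector depends only on
  the ball b + a Z_p. These balls are the vertices of the tree; smaller balls lie further from the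
  end fixed by the mirabolic group.\<close>

definition E :: "'p padic \<Rightarrow> 'p padic \<Rightarrow> 'v" where
  "E a b = \<rho> (mtx a b 0 1) W"

lemma act_E: "x \<noteq> 0 \<Longrightarrow> a \<noteq> 0 \<Longrightarrow> \<rho> (mtx x y 0 1) (E a b) = E (x * a) (x * b + y)"
  by (simp add: E_def act_mult[symmetric] mtx_GL2_Qp_iff mtx_mult)

lemma E_unit:
  assumes "a \<noteq> 0" "u \<in> Zp_units"
  shows "E (a * u) b = E a b"
proof -
  have "mtx u 0 0 1 \<in> GL2_Zp" using assms by (simp add: mtx_GL2_Zp_iff Zp_units_subset)
  then show ?thesis
    using act_integral[of "mtx a b 0 1" "mtx u 0 0 1"] assms
    by (simp add: E_def mtx_mult mtx_GL2_Qp_iff)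
qed

lemma E_shift:
  assumes "a \<noteq> 0" "z \<in> Zp"
  shows "E a (b + a * z) = E a b"
proof -
  have "mtx 1 z 0 1 \<in> GL2_Zp" using assms by (simp add: mtx_GL2_Zp_iff)
  then show ?thesis
    using act_integral[of "mtx a b 0 1" "mtx 1 z 0 1"] assms
    by (simp add: E_def mtx_mult mtx_GL2_Qp_iff add.commute)
qed

text \<open>The Hecke operator at p applied to \<open>W\<close>: the matrices are representatives of
  the p + 1 left cosets of GL2(Z_p) in the double coset of diag(p, 1).\<close>

definition hecke_vector :: 'v where
  "hecke_vector = (\<Sum>c<CARD('p). E padic_p (of_nat c)) + \<rho> (mtx 1 0 0 padic_p) W"

section \<open>Invariance of the Hecke vector under GL2(Z_p)\<close>

lemma hecke_vector_translate:
  assumes "b \<in> Zp"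
  shows "\<rho> (mtx 1 b 0 1) hecke_vector = hecke_vector"
proof -
  note p = padic_p_nonzero[where 'p='p]
  have G: "mtx 1 b 0 1 \<in> GL2_Qp" "mtx 1 0 0 padic_p \<in> (GL2_Qp :: ('p padic ^ 2 ^ 2) set)"
    using p by (simp_all add: mtx_GL2_Qp_iff)
  \<comment> \<open>Moving the translation past diag(1, p) multiplies b by p, so it stays integral
    and the last coset is fixed. The other cosets are permuted by c -> c + b.\<close>
  have "mtx 1 (padic_p * b) 0 1 \<in> GL2_Zp" using assms by (simp add: mtx_GL2_Zp_iff Zp_mult)
  from act_integral[OF G(2) this]
  have "\<rho> (mtx 1 b 0 1) (\<rho> (mtx 1 0 0 padic_p) W) = \<rho> (mtx 1 0 0 padic_p) W"
    by (simp add: act_mult[OF G, symmetric] mtx_mult mult.commute)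
  moreover have "(\<Sum>c<CARD('p). E padic_p (of_nat c + b)) = (\<Sum>c<CARD('p). E padic_p (of_nat c))"
    using assms p by (intro sum_residues) (auto simp: E_shift nat_diff_unit)
  ultimately show ?thesis
    using G p by (simp add: hecke_vector_def act_add act_sum act_E)
qed

lemma hecke_vector_diagonal:
  assumes "a \<in> Zp_units" "d \<in> Zp_units"
  shows "\<rho> (mtx a 0 0 d) hecke_vector = hecke_vector"
proof -
  note p = padic_p_nonzero[where 'p='p]
  have nz: "a \<noteq> 0" "d \<noteq> 0" using assms Zp_units_nonzero by blast+
  have u: "a / d \<in> Zp_units" using assms by (rule Zp_units_divide)
  have G: "mtx a 0 0 d \<in> GL2_Qp" "mtx 1 0 0 padic_p \<in> (GL2_Qp :: ('p padic ^ 2 ^ 2) set)"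
    "mtx padic_p x 0 1 \<in> (GL2_Qp :: ('p padic ^ 2 ^ 2) set)" for x
    using p nz by (simp_all add: mtx_GL2_Qp_iff)
  have K: "mtx a 0 0 d \<in> GL2_Zp"
    using assms by (simp add: mtx_GL2_Zp_iff Zp_units_subset Zp_units_mult)
  have "\<rho> (mtx a 0 0 d) (\<rho> (mtx 1 0 0 padic_p) W) = \<rho> (mtx 1 0 0 padic_p) W"
    using act_integral[OF G(2) K] by (simp add: act_mult[OF G(1,2), symmetric] mtx_mult mult.commute)
  moreover have "\<rho> (mtx a 0 0 d) (E padic_p x) = E padic_p (x * (a / d))" for x
    using act_integral[OF G(3)[of "x * (a / d)"] K] nz
    by (simp add: E_def act_mult[OF G(1,3), symmetric] mtx_mult mult.commute)
  moreover have "(\<Sum>c<CARD('p). E padic_p (of_nat c * (a / d))) = (\<Sum>c<CARD('p). E padic_p (of_nat c))"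
  proof (rule sum_residues)
    show "of_nat c * (a / d) - of_nat c' * (a / d) \<in> Zp_units"
      if "c < CARD('p)" "c' < CARD('p)" "c \<noteq> c'" for c c'
      using Zp_units_mult[OF nat_diff_unit[OF that] u] by (simp only: left_diff_distrib)
    show "of_nat c * (a / d) \<in> Zp" for c
      by (intro Zp_mult Zp_of_nat Zp_units_subset[OF u])
  qed (use p in \<open>simp add: E_shift\<close>)
  ultimately show ?thesis
    using G p by (simp add: hecke_vector_def act_add act_sum)
qed

text \<open>The swap exchanges the coset c = 0 with the last coset and sends every other c to its
  inverse modulo p.\<close>

lemma hecke_vector_swap: "\<rho> (mtx 0 1 1 0) hecke_vector = hecke_vector"
proof -
  note p = padic_p_nonzero[where 'p='p]
  have p0: "0 < CARD('p)" by simp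
  let ?w = "mtx 0 1 1 0 :: 'p padic ^ 2 ^ 2"
  let ?D = "\<rho> (mtx 1 0 0 padic_p) W"
  \<comment> \<open>The convention \<open>inverse 0 = 0\<close> lets \<open>\<sigma>\<close> permute
    all residues while fixing 0, so \<open>sum_residues\<close> applies to the full range; the term
    c = 0 is split off afterwards.\<close>
  define \<sigma> where "\<sigma> c = inverse (of_nat c :: 'p padic)" for c
  have unit: "\<sigma> c \<in> Zp_units" if "c \<noteq> 0" "c < CARD('p)" for c
    using that by (auto simp: \<sigma>_def intro!: Zp_units_inverse nat_unit)
  have G: "?w \<in> GL2_Qp" "mtx 1 0 0 padic_p \<in> (GL2_Qp :: ('p padic ^ 2 ^ 2) set)"
    "mtx padic_p x 0 1 \<in> (GL2_Qp :: ('p padic ^ 2 ^ 2) set)" for x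
    using p by (simp_all add: mtx_GL2_Qp_iff)
  have w: "?w \<in> GL2_Zp" by (simp add: mtx_GL2_Zp_iff Zp_units_minus_1)
  have D: "\<rho> ?w ?D = E padic_p 0"
    using act_integral[OF G(3) w, of 0] by (simp add: E_def act_mult[OF G(1,2), symmetric] mtx_mult)
  have E0: "\<rho> ?w (E padic_p 0) = ?D"
    using act_integral[OF G(2) w] by (simp add: E_def act_mult[OF G(1,3), symmetric] mtx_mult)
  have E1: "\<rho> ?w (E padic_p (of_nat c)) = E padic_p (\<sigma> c)" if "c \<noteq> 0" "c < CARD('p)" for c
  proof -
    have "of_nat c \<noteq> (0 :: 'p padic)" using that nat_unit[of c, where 'p='p] Zp_units_nonzero by blast
    \<comment> \<open>The product on the right has rows (0, 1) and (p, c). As c is a unit, an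
      integral right factor of determinant -1 can be split off, leaving an upper triangular
      matrix.\<close>
    then have "mtx padic_p (\<sigma> c) 0 1 ** mtx (- \<sigma> c) 0 padic_p (of_nat c) = ?w ** mtx padic_p (of_nat c) 0 1"
      by (simp add: mtx_mult mtx_eq_iff \<sigma>_def)
    moreover have "mtx (- \<sigma> c) 0 padic_p (of_nat c) \<in> GL2_Zp"
      using unit[OF that] that
      by (auto simp: mtx_GL2_Zp_iff intro!: Zp_minus Zp_units_subset Zp_units_minus Zp_units_mult nat_unit)
    ultimately show ?thesis
      unfolding E_def act_mult[OF G(1,3), symmetric] using act_integral[OF G(3)] by metis
  qed
  have "(\<Sum>c<CARD('p). E padic_p (\<sigma> c)) = (\<Sum>c<CARD('p). E padic_p (of_nat c))"
  proof (rule sum_residues)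
    show "\<sigma> c \<in> Zp" if "c < CARD('p)" for c
      using unit[OF _ that] Zp_units_subset by (cases "c = 0") (auto simp: \<sigma>_def)
    show "\<sigma> c - \<sigma> c' \<in> Zp_units" if c: "c < CARD('p)" "c' < CARD('p)" "c \<noteq> c'" for c c'
    proof (cases "c = 0 \<or> c' = 0")
      case True
      then show ?thesis using c unit[of c] Zp_units_minus[OF unit[of c']] by (auto simp: \<sigma>_def)
    next
      case False
      then have "of_nat c \<noteq> (0 :: 'p padic)" "of_nat c' \<noteq> (0 :: 'p padic)"
        using c nat_unit[where 'p='p] Zp_units_nonzero by blast+
      then have "\<sigma> c - \<sigma> c' = (of_nat c' - of_nat c) * (\<sigma> c * \<sigma> c')"
        by (simp add: \<sigma>_def field_simps)
      then show ?thesis using False c unit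
        by (auto intro!: Zp_units_mult nat_diff_unit)
    qed
  qed (use p in \<open>simp add: E_shift\<close>)
  moreover have split: "sum f {..<CARD('p)} = f 0 + sum f {1..<CARD('p)}" for f :: "nat \<Rightarrow> 'v"
    using p0 by (simp add: lessThan_atLeast0 sum.atLeast_Suc_lessThan)
  moreover have "(\<Sum>c=1..<CARD('p). \<rho> ?w (E padic_p (of_nat c))) = (\<Sum>c=1..<CARD('p). E padic_p (\<sigma> c))"
    using E1 by (intro sum.cong) auto
  ultimately show ?thesis
    using G by (simp add: hecke_vector_def act_add act_sum D E0 \<sigma>_def add_ac)
qed

text \<open>Conjugation by the swap turns upper into lower unipotents. A matrix in GL2(Z_p) with
  unit lower right corner is upper unipotent times diagonal times lower unipotent. Otherwise its
  lower left entry is a unit, because the determinant is, and interchanging the columns reduces to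
  the first case.\<close>

lemma hecke_vector_spherical: "hecke_vector \<in> spherical \<rho>"
proof -
  let ?w = "mtx 0 1 1 0 :: 'p padic ^ 2 ^ 2"
  have G: "?w \<in> GL2_Qp" "mtx 1 b 0 1 \<in> (GL2_Qp :: ('p padic ^ 2 ^ 2) set)"
    "mtx 1 0 b 1 \<in> (GL2_Qp :: ('p padic ^ 2 ^ 2) set)" for b
    by (simp_all add: mtx_GL2_Qp_iff)
  have lower: "\<rho> (mtx 1 0 c 1) hecke_vector = hecke_vector" if "c \<in> Zp" for c
  proof -
    have "mtx 1 0 c 1 = ?w ** (mtx 1 c 0 1 ** ?w)" by (simp add: mtx_mult)
    moreover have "mtx 1 c 0 1 ** ?w \<in> GL2_Qp" by (simp add: mtx_mult mtx_GL2_Qp_iff)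
    ultimately show ?thesis
      by (simp add: act_mult G hecke_vector_swap hecke_vector_translate[OF that])
  qed
  have unit_corner: "\<rho> (mtx a b c d) hecke_vector = hecke_vector"
    if K: "mtx a b c d \<in> GL2_Zp" and d: "d \<in> Zp_units" for a b c d
  proof -
    let ?e = "(a * d - b * c) / d"
    have d0: "d \<noteq> 0" using d by (rule Zp_units_nonzero)
    have e: "?e \<in> Zp_units" using K d by (intro Zp_units_divide) (auto simp: mtx_GL2_Zp_iff)
    then have e0: "?e \<noteq> 0" by (rule Zp_units_nonzero)
    have Zp: "b / d \<in> Zp" "c / d \<in> Zp"
      using K Zp_units_subset[OF Zp_units_inverse[OF d]]
      by (auto simp: mtx_GL2_Zp_iff divide_inverse intro!: Zp_mult)
    have "mtx a b c d = mtx 1 (b / d) 0 1 ** (mtx ?e 0 0 d ** mtx 1 0 (c / d) 1)"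
      using d0 by (simp add: mtx_mult mtx_eq_iff field_simps)
    moreover have "mtx ?e 0 0 d \<in> GL2_Qp" "mtx ?e 0 0 d ** mtx 1 0 (c / d) 1 \<in> GL2_Qp"
      using e0 d0 by (simp_all add: mtx_mult mtx_GL2_Qp_iff)
    ultimately show ?thesis
      by (simp add: act_mult G lower[OF Zp(2)] hecke_vector_translate[OF Zp(1)]
          hecke_vector_diagonal[OF e d])
  qed
  have "\<rho> g hecke_vector = hecke_vector" if "g \<in> GL2_Zp" for g
  proof (cases g rule: mtx_cases)
    case (1 a b c d)
    with that have K: "mtx a b c d \<in> GL2_Zp" by simp
    then have Z: "a \<in> Zp" "b \<in> Zp" "c \<in> Zp" "d \<in> Zp" "a * d - b * c \<in> Zp_units"
      by (simp_all add: mtx_GL2_Zp_iff)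
    from Z(4) show ?thesis
    proof (cases rule: Zp_unit_or_divisible)
      case d: 1
      show ?thesis unfolding 1 using K d by (rule unit_corner)
    next
      case d: (2 y)
      have c: "c \<in> Zp_units" using Z(3)
      proof (cases rule: Zp_unit_or_divisible)
        case c: (2 x)
        have "a * d - b * c = padic_p * (a * y - b * x)" by (simp add: c d algebra_simps)
        moreover have "a * y - b * x \<in> Zp" using Z c d by (intro Zp_diff Zp_mult)
        ultimately show ?thesis using Z(5) p_multiple_not_unit by metis
      qed
      have K': "mtx b a d c \<in> GL2_Zp"
        using Z Zp_units_minus[OF Z(5)] by (simp add: mtx_GL2_Zp_iff)
      have "g = mtx b a d c ** ?w" by (simp add: 1 mtx_mult)
      then show ?thesis
        by (simp add: act_mult G GL2_Zp_subset[OF K'] hecke_vector_swap unit_corner[OF K' c])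
    qed
  qed
  then show ?thesis by (simp add: spherical_def)
qed

text \<open>The Hecke vector lies on the spherical line, so it is t \<open>W\<close>; translating by
  the mirabolic group carries this to every vertex. The sum runs over the p children of the vertex,
  and \<open>E (a / padic_p) b\<close> is its parent towards the fixed end.\<close>

lemma hecke_relation:
  obtains t where "\<And>a b. a \<noteq> 0 \<Longrightarrow>
    (\<Sum>c<CARD('p). E (a * padic_p) (b + a * of_nat c)) +
      s (central_character s \<rho> padic_p) (E (a / padic_p) b) = s t (E a b)"
proof -
  note p = padic_p_nonzero[where 'p='p]
  let ?\<omega> = "central_character s \<rho> padic_p"
  obtain t where t: "hecke_vector = s t W" using hecke_vector_spherical by (rule spherical_multiple)
  have M: "mat padic_p \<in> (GL2_Qp :: ('p padic ^ 2 ^ 2) set)"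
    "mtx (1 / padic_p) 0 0 1 \<in> (GL2_Qp :: ('p padic ^ 2 ^ 2) set)"
    using p by (simp_all add: mat_mtx mtx_GL2_Qp_iff)
  \<comment> \<open>The last coset is brought into the mirabolic group by splitting off the central
    element p; this is where the central character enters.\<close>
  have "mtx 1 0 0 padic_p = (mat padic_p :: 'p padic ^ 2 ^ 2) ** mtx (1 / padic_p) 0 0 1"
    using p by (simp add: mat_mtx mtx_mult)
  then have D: "\<rho> (mtx 1 0 0 padic_p) W = s ?\<omega> (E (1 / padic_p) 0)"
    by (simp only: act_mult[OF M] central_character[OF p] E_def)
  show thesis
  proof (rule that)
    fix a b :: "'p padic" assume a: "a \<noteq> 0"
    have G: "mtx a b 0 1 \<in> GL2_Qp" using a by (simp add: mtx_GL2_Qp_iff)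
    have "\<rho> (mtx a b 0 1) hecke_vector = s t (E a b)" by (simp add: t act_scale[OF G] E_def)
    then show "(\<Sum>c<CARD('p). E (a * padic_p) (b + a * of_nat c)) + s ?\<omega> (E (a / padic_p) b) = s t (E a b)"
      using a p G by (simp add: hecke_vector_def D act_add act_sum act_scale act_E add.commute)
  qed
qed

text \<open>This is the Iwasawa decomposition of \<open>GL2_Qp\<close>.\<close>

lemma act_W_multiple_E:
  assumes "g \<in> GL2_Qp"
  shows "\<exists>c a b. a \<noteq> 0 \<and> \<rho> g W = s c (E a b)"
proof -
  have main: "\<exists>z x y. x \<noteq> 0 \<and> \<rho> (mtx a b c d) W = s z (E x y)"
    if g: "mtx a b c d \<in> GL2_Qp" and d: "d \<noteq> 0" "c / d \<in> Zp" for a b c d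
  proof -
    \<comment> \<open>After the scalar d and the lower unipotent with entry c / d are removed,
      comparing determinants forces \<open>?x\<close> and the last column forces
      \<open>?y\<close>.\<close>
    let ?x = "(a * d - b * c) / d\<^sup>2" and ?y = "b / d"
    have x: "?x \<noteq> 0" using g d by (simp add: mtx_GL2_Qp_iff)
    have G: "mat d \<in> GL2_Qp" "mtx ?x ?y 0 1 \<in> GL2_Qp" "mat d ** mtx ?x ?y 0 1 \<in> GL2_Qp"
      using x d by (simp_all add: mat_mtx mtx_mult mtx_GL2_Qp_iff)
    have K: "mtx 1 0 (c / d) 1 \<in> GL2_Zp" using d by (simp add: mtx_GL2_Zp_iff)
    have "mtx a b c d = mat d ** mtx ?x ?y 0 1 ** mtx 1 0 (c / d) 1"
      using d by (simp add: mat_mtx mtx_mult mtx_eq_iff field_simps power2_eq_square)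
    then have "\<rho> (mtx a b c d) W = s (central_character s \<rho> d) (E ?x ?y)"
      by (simp add: act_integral[OF G(3) K] act_mult[OF G(1,2)] central_character[OF d(1)] E_def)
    then show ?thesis using x by blast
  qed
  obtain a b c d where g: "g = mtx a b c d" by (rule mtx_cases)
  show ?thesis
  proof (cases rule: Zp_dichotomy[where x = d and y = c])
    \<comment> \<open>The swap fixes \<open>W\<close> and interchanges the columns, so that the
      quotient of the bottom row becomes the integral one.\<close>
    case 1
    have w: "mtx 0 1 1 0 \<in> (GL2_Zp :: ('p padic ^ 2 ^ 2) set)"
      by (simp add: mtx_GL2_Zp_iff Zp_units_minus_1)
    have G: "mtx b a d c \<in> GL2_Qp" using assms g by (auto simp: mtx_GL2_Qp_iff)
    have "g = mtx b a d c ** mtx 0 1 1 0" by (simp add: g mtx_mult)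
    then show ?thesis using main[OF G 1] act_integral[OF G w] by metis
  next
    case 2
    then show ?thesis using main assms g by metis
  next
    case 3
    then show ?thesis using assms g by (simp add: mtx_GL2_Qp_iff)
  qed
qed

lemma span_E: "span {E a b | a b. a \<noteq> 0} = UNIV"
proof -
  have "\<rho> g v \<in> span {E a b | a b. a \<noteq> 0}" if g: "g \<in> GL2_Qp" and v: "v \<in> spherical \<rho>" for g v
  proof -
    obtain c where "v = s c W" using v by (rule spherical_multiple)
    moreover obtain d a b where "a \<noteq> 0" "\<rho> g W = s d (E a b)" using act_W_multiple_E[OF g] by blast
    moreover from this have "E a b \<in> span {E a b | a b. a \<noteq> 0}" by (intro span_base) blast
    ultimately show ?thesis by (simp add: act_scale[OF g] span_scale)
  qed
  then have "{\<rho> g v | g v. g \<in> GL2_Qp \<and> v \<in> spherical \<rho>} \<subseteq> span {E a b | a b. a \<noteq> 0}" by blast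
  then have "span {\<rho> g v | g v. g \<in> GL2_Qp \<and> v \<in> spherical \<rho>} \<subseteq> span {E a b | a b. a \<noteq> 0}"
    by (rule span_minimal) (rule subspace_span)
  then show ?thesis using nondeg unfolding nondegenerate_def by blast
qed

end

section \<open>Kernels on pairs of vertices of the tree\<close>

text \<open>An abstraction of the form evaluated on pairs of vertex vectors. The Hecke relation is
  imposed in the first vertex only; the one in the second is obtained by a second instance with the
  two vertices exchanged.\<close>

locale hecke_kernel =
  fixes L :: "'p :: prime_card padic \<Rightarrow> 'p padic \<Rightarrow> 'p padic \<Rightarrow> 'p padic \<Rightarrow> 'k :: field"
    and \<omega> t :: 'k
  assumes unit1: "\<lbrakk>a \<noteq> 0; a' \<noteq> 0; u \<in> Zp_units\<rbrakk> \<Longrightarrow> L (a * u) b a' b' = L a b a' b'"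
    and unit2: "\<lbrakk>a \<noteq> 0; a' \<noteq> 0; u \<in> Zp_units\<rbrakk> \<Longrightarrow> L a b (a' * u) b' = L a b a' b'"
    and shift1: "\<lbrakk>a \<noteq> 0; a' \<noteq> 0; z \<in> Zp\<rbrakk> \<Longrightarrow> L a (b + a * z) a' b' = L a b a' b'"
    and shift2: "\<lbrakk>a \<noteq> 0; a' \<noteq> 0; z \<in> Zp\<rbrakk> \<Longrightarrow> L a b a' (b' + a' * z) = L a b a' b'"
    and equivariant: "\<lbrakk>x \<noteq> 0; a \<noteq> 0; a' \<noteq> 0\<rbrakk> \<Longrightarrow>
      L (x * a) (x * b + y) (x * a') (x * b' + y) = delta_P (mtx x y 0 1) * L a b a' b'"
    and hecke: "\<lbrakk>a \<noteq> 0; a' \<noteq> 0\<rbrakk> \<Longrightarrow>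
      (\<Sum>c<CARD('p). L (a * padic_p) (b + a * of_nat c) a' b') + \<omega> * L (a / padic_p) b a' b'
        = t * L a b a' b'"
    and p_nonzero: "of_nat CARD('p) \<noteq> (0 :: 'k)"
begin

lemma delta_unit: "u \<in> Zp_units \<Longrightarrow> delta_P (mtx u b c d :: 'p padic ^ 2 ^ 2) = (1 :: 'k)"
  using delta_P_mtx[of u 0 b c d] by simp

lemma delta_p: "delta_P (mtx padic_p b c d :: 'p padic ^ 2 ^ 2) = inverse (of_nat CARD('p) :: 'k)"
  using delta_P_mtx[of "1 :: 'p padic" 1 b c d] by simp

lemma translate: "a \<noteq> 0 \<Longrightarrow> a' \<noteq> 0 \<Longrightarrow> L a (b + y) a' (b' + y) = L a b a' b'"
  using equivariant[of 1 a a' b y b'] by (simp add: delta_unit)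

lemma scale_unit:
  assumes "a \<noteq> 0" "a' \<noteq> 0" "u \<in> Zp_units"
  shows "L a (u * b) a' (u * b') = L a b a' b'"
proof -
  have "L (a * u) (u * b) (a' * u) (u * b') = L a b a' b'"
    using equivariant[of u a a' b 0 b'] Zp_units_nonzero[OF assms(3)] assms
    by (simp add: delta_unit mult.commute)
  then show ?thesis using assms Zp_units_nonzero[OF assms(3)] by (simp add: unit1 unit2)
qed

lemma scale_p:
  assumes "a \<noteq> 0" "a' \<noteq> 0"
  shows "L (padic_p * a) (padic_p * b) (padic_p * a') (padic_p * b')
    = inverse (of_nat CARD('p)) * L a b a' b'"
  using equivariant[of padic_p a a' b 0 b'] padic_p_nonzero[where 'p='p] assms
  by (simp add: delta_p)

text \<open>For normalising a pair of vertices when only vanishing matters, without tracking powers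
  of p.\<close>

lemma scale_eq_0_iff:
  assumes "x \<noteq> 0" "a \<noteq> 0" "a' \<noteq> 0"
  shows "L (x * a) (x * b) (x * a') (x * b') = 0 \<longleftrightarrow> L a b a' b' = 0"
  using equivariant[OF assms, of b 0 b'] delta_P_nonzero[OF p_nonzero assms(1), of 0 0 1] by simp

lemma shift1_1:
  assumes "a' \<noteq> 0" "z \<in> Zp"
  shows "L 1 0 a' z = L 1 0 a' 1"
proof -
  have "1 - z \<in> Zp" using assms by (intro Zp_diff Zp_1)
  then show ?thesis
    using translate[of 1 a' 0 "1 - z" z] shift1[of 1 a' "1 - z" 0 1] assms by simp
qed

lemma shift2_1:
  assumes "a \<noteq> 0" "z \<in> Zp"
  shows "L a 0 1 z = L a 0 1 1"
proof -
  have "1 - z \<in> Zp" using assms by (intro Zp_diff Zp_1)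
  then show ?thesis using shift2[of a 1 "1 - z" 0 z] assms by simp
qed

text \<open>Modulo the center, the vertices of the tree are the pairs \<open>(a, b)\<close>.  The value \<open>F i j\<close> is
  attained on pairs of vertices at distances \<open>i\<close> and \<open>j\<close> from the vertex \<open>(1, 0)\<close> where their
  rays towards the end fixed by the mirabolic subgroup meet.\<close>

definition F :: "nat \<Rightarrow> nat \<Rightarrow> 'k" where
  "F i j = L (padic_p ^ i) 0 (padic_p ^ j) 1"

section \<open>Recursions for the values at normalised pairs\<close>

lemma F_unit:
  assumes "u \<in> Zp_units"
  shows "L (padic_p ^ i) 0 (padic_p ^ j) u = F i j"
  using scale_unit[of "padic_p ^ i" "padic_p ^ j" u 0 1] padic_p_nonzero[where 'p='p] assms
  by (simp add: F_def)

lemma F_difference: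
  assumes "b' - b \<in> Zp_units"
  shows "L (padic_p ^ i) b (padic_p ^ j) b' = F i j"
  using translate[of "padic_p ^ i" "padic_p ^ j" 0 b "b' - b"] F_unit[OF assms]
    padic_p_nonzero[where 'p='p] by simp

lemma F_swap: "L (padic_p ^ i) 1 (padic_p ^ j) 0 = F i j"
  by (rule F_difference) (simp add: Zp_units_minus_1)

text \<open>The first ball is Z_p and contains every integral z, so 1 may be replaced by z. In
  particular z = 0 identifies \<open>F 0 0\<close> with the value at two equal vertices.\<close>

lemma F_0_left:
  assumes "z \<in> Zp"
  shows "L 1 0 (padic_p ^ j) z = F 0 j"
  using shift1_1[of "padic_p ^ j" z] padic_p_nonzero[where 'p='p] assms by (simp add: F_def)

lemma F_0_right:
  assumes "z \<in> Zp"
  shows "L (padic_p ^ i) 0 1 z = F i 0"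
  using shift2_1[of "padic_p ^ i" z] padic_p_nonzero[where 'p='p] assms by (simp add: F_def)

text \<open>The parent of Z_p contains the second vertex at distance j + 1. Scaling that parent back
  to Z_p by p produces the factor from \<open>delta_P\<close>.\<close>

lemma F_up: "L (1 / padic_p) 0 (padic_p ^ j) 1 = of_nat CARD('p) * F 0 (Suc j)"
proof -
  note p = padic_p_nonzero[where 'p='p]
  have "F 0 (Suc j) = L 1 0 (padic_p * padic_p ^ j) padic_p"
    using F_0_left[of padic_p "Suc j"] by simp
  also have "\<dots> = inverse (of_nat CARD('p)) * L (1 / padic_p) 0 (padic_p ^ j) 1"
    using scale_p[of "1 / padic_p" "padic_p ^ j" 0 1] p by simp
  finally show ?thesis using p_nonzero by simp
qed

text \<open>The first vertex lies strictly below the meeting vertex, so all its children are one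
  step further away and its parent is one step closer.\<close>

lemma F_rec: "of_nat CARD('p) * F (Suc (Suc i)) j + \<omega> * F i j = t * F (Suc i) j"
proof -
  note p = padic_p_nonzero[where 'p='p]
  have "L (padic_p ^ Suc i * padic_p) (0 + padic_p ^ Suc i * of_nat c) (padic_p ^ j) 1 = F (Suc (Suc i)) j"
    for c
    using F_difference[OF one_minus_p_power_unit[OF Zp_of_nat[of c], of i], of "Suc (Suc i)" j]
    by (simp add: ac_simps)
  then have "(\<Sum>c<CARD('p). L (padic_p ^ Suc i * padic_p) (0 + padic_p ^ Suc i * of_nat c) (padic_p ^ j) 1)
    = of_nat CARD('p) * F (Suc (Suc i)) j"
    by simp
  then show ?thesis
    using hecke[of "padic_p ^ Suc i" "padic_p ^ j" 0 1] p by (simp add: F_def)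
qed

text \<open>The Hecke relation at two equal vertices: all p children are in the same relative
  position, and the parent is handled by \<open>F_up\<close>.\<close>

lemma F_rec_00: "of_nat CARD('p) * F 1 0 + \<omega> * (of_nat CARD('p) * F 0 1) = t * F 0 0"
proof -
  have "L (1 * padic_p) (0 + 1 * of_nat c) 1 1 = F 1 0" for c
    using translate[of padic_p 1 0 "of_nat c" "1 - of_nat c"] F_0_right[of "1 - of_nat c" 1]
      padic_p_nonzero[where 'p='p] by (simp add: Zp_diff)
  then show ?thesis using hecke[of 1 1 0 1] F_up[of 0] by (simp add: F_def)
qed

text \<open>The first vertex is the meeting vertex and the second lies strictly below it, through
  the child of residue 1. The other p - 1 children branch off, which is the source of the
  coefficient p - 1.\<close>

lemma F_rec_0:
  "of_nat (CARD('p) - 1) * F 1 (Suc j) + inverse (of_nat CARD('p)) * F 0 j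
    + \<omega> * (of_nat CARD('p) * F 0 (Suc (Suc j))) = t * F 0 (Suc j)"
proof -
  note p = padic_p_nonzero[where 'p='p]
  have p1: "1 < CARD('p)" using prime_card[where 'a='p] by (rule prime_gt_1_nat)
  let ?f = "\<lambda>c. L (1 * padic_p) (0 + 1 * of_nat c) (padic_p ^ Suc j) 1"
  have "?f c = F 1 (Suc j)" if "c < CARD('p)" "c \<noteq> 1" for c
  proof -
    have "1 - of_nat c \<in> (Zp_units :: 'p padic set)"
      using nat_diff_unit[of 1 c, where 'p='p] that p1 by simp
    then show ?thesis using F_difference[of 1 "of_nat c" 1 "Suc j"] by simp
  qed
  then have "(\<Sum>c\<in>{..<CARD('p)} - {1}. ?f c) = of_nat (CARD('p) - 1) * F 1 (Suc j)"
    using p1 by simp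
  \<comment> \<open>This child lies on the path to the second vertex; both balls are then divided by
    p, at the cost of the inverse of p.\<close>
  moreover have "?f 1 = inverse (of_nat CARD('p)) * F 0 j"
    using translate[of padic_p "padic_p ^ Suc j" 0 1 0] scale_p[of 1 "padic_p ^ j" 0 0]
      F_0_left[of 0 j] p by simp
  moreover have "(\<Sum>c<CARD('p). ?f c) = ?f 1 + (\<Sum>c\<in>{..<CARD('p)} - {1}. ?f c)"
    using p1 by (intro sum.remove) auto
  ultimately show ?thesis
    using hecke[of 1 "padic_p ^ Suc j" 0 1] F_up[of "Suc j"] p by (simp add: F_def add_ac)
qed

text \<open>By translation and by scaling with an element of maximal norm among \<open>a\<close>, \<open>a'\<close> and
  \<open>b' - b\<close>, every pair of vertices is brought into the position described by \<open>F\<close>.\<close>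

lemma vanishes_of_F:
  assumes F: "\<And>i j. F i j = 0" and a: "a \<noteq> 0" "a' \<noteq> 0"
  shows "L a b a' b' = 0"
proof -
  have F': "L a 0 a' 1 = 0" if "a \<in> Zp" "a' \<in> Zp" "a \<noteq> 0" "a' \<noteq> 0" for a a'
  proof -
    obtain i u where u: "u \<in> Zp_units" "a = padic_p ^ i * u"
      using \<open>a \<in> Zp\<close> \<open>a \<noteq> 0\<close> by (rule Zp_decomp)
    obtain j v where v: "v \<in> Zp_units" "a' = padic_p ^ j * v"
      using \<open>a' \<in> Zp\<close> \<open>a' \<noteq> 0\<close> by (rule Zp_decomp)
    show ?thesis
      using F[of i j] padic_p_nonzero[where 'p='p] u v Zp_units_nonzero[OF v(1)]
      by (simp add: unit1 unit2 F_def)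
  qed
  define d where "d = b' - b"
  have trans: "x / z \<in> Zp" if "x / y \<in> Zp" "y / z \<in> Zp" "y \<noteq> 0" for x y z :: "'p padic"
    using Zp_mult[OF that(1,2)] that(3) by simp
  have scale: "L a 0 a' d = 0 \<longleftrightarrow> L (a / x) 0 (a' / x) (d / x) = 0" if "x \<noteq> 0" for x
    using scale_eq_0_iff[of x "a / x" "a' / x" 0 "d / x"] that a by simp
  consider "a' / a \<in> Zp" "d / a \<in> Zp" | "a / a' \<in> Zp" "d / a' \<in> Zp"
    | "d \<noteq> 0" "a / d \<in> Zp" "a' / d \<in> Zp"
  proof (cases rule: Zp_dichotomy[where x = a and y = a'])
    case aa': 1
    show thesis
      using that aa' a trans[of a a' d] by (cases rule: Zp_dichotomy[where x = a' and y = d]) auto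
  next
    case aa': 2
    show thesis
      using that aa' a trans[of a' a d] by (cases rule: Zp_dichotomy[where x = a and y = d]) auto
  qed (use a in simp)
  then have "L a 0 a' d = 0"
  proof cases
    \<comment> \<open>After scaling by a the first ball is Z_p and contains d / a, so that this
      difference may be replaced by the 1 that \<open>F'\<close> expects. Case 2 is
      symmetric.\<close>
    case 1
    then show ?thesis using scale[OF a(1)] F'[of 1 "a' / a"] shift1_1[of "a' / a" "d / a"] a by simp
  next
    case 2
    then show ?thesis using scale[OF a(2)] F'[of "a / a'" 1] shift2_1[of "a / a'" "d / a'"] a by simp
  next
    case 3
    then show ?thesis using scale[of d] F'[of "a / d" "a' / d"] a by simp
  qed
  then show ?thesis using translate[OF a, of 0 b d] by (simp add: d_def)
qed

end

section \<open>Elimination of all values\<close>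

lemma hecke_kernel_vanishes:
  fixes L :: "'p :: prime_card padic \<Rightarrow> 'p padic \<Rightarrow> 'p padic \<Rightarrow> 'p padic \<Rightarrow> 'k :: field"
  assumes "hecke_kernel L \<omega> t" "hecke_kernel (\<lambda>a b a' b'. L a' b' a b) \<omega>' t'"
    and nz: "of_nat (CARD('p) - 1) \<noteq> (0 :: 'k)" and \<omega>: "\<omega> * \<omega>' \<noteq> 1"
    and base: "L 1 0 1 0 = 0" and a: "a \<noteq> 0" "a' \<noteq> 0"
  shows "L a b a' b' = 0"
proof -
  interpret hecke_kernel L \<omega> t by fact
  interpret swap: hecke_kernel "\<lambda>a b a' b'. L a' b' a b" \<omega>' t' by fact
  let ?p = "of_nat CARD('p) :: 'k"
  \<comment> \<open>The exchanged kernel has the transposed values, so its recursions become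
    recursions in the second index.\<close>
  have swap_F: "swap.F j i = F i j" for i j
    using F_swap[of i j] by (simp add: swap.F_def)
  have F00: "F 0 0 = 0" using F_0_left[of 0 0] base by simp
  \<comment> \<open>With \<open>F 0 0 = 0\<close> the two relations at equal vertices form a
    homogeneous system in \<open>F 1 0\<close> and \<open>F 0 1\<close> of determinant
    \<open>1 - \<omega> * \<omega>'\<close> up to a power of p.\<close>
  have "?p * (F 1 0 + \<omega> * F 0 1) = 0" "?p * (F 0 1 + \<omega>' * F 1 0) = 0"
    using F_rec_00 swap.F_rec_00 F00 by (simp_all add: swap_F algebra_simps)
  then have 1: "F 1 0 = - \<omega> * F 0 1" "F 0 1 = - \<omega>' * F 1 0"
    using p_nonzero by (simp_all add: eq_neg_iff_add_eq_0)
  then have "(1 - \<omega> * \<omega>') * F 0 1 = 0" by (simp add: algebra_simps)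
  then have F01: "F 0 1 = 0" using \<omega> by simp
  then have F10: "F 1 0 = 0" using 1 by simp
  have F0: "F 0 j = 0 \<and> F 0 (Suc j) = 0" for j
  proof (induction j)
    case (Suc j)
    then show ?case using swap.F_rec[of j 0] p_nonzero by (simp add: swap_F)
  qed (use F00 F01 in simp)
  \<comment> \<open>Once the values \<open>F 0 j\<close> vanish, \<open>F_rec_0\<close> reduces to
    (p - 1) \<open>F 1 j\<close> = 0 for j > 0; the case j = 0 is \<open>F10\<close>.\<close>
  have F1: "F 1 j = 0" for j
    using F_rec_0[of "j - 1"] F0 F10 nz by (cases j) auto
  have "F i j = 0 \<and> F (Suc i) j = 0" for i j
  proof (induction i)
    case (Suc i)
    then show ?case using F_rec[of i j] p_nonzero by simp
  qed (use F0 F1 in simp)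
  then show ?thesis using vanishes_of_F a by blast
qed

section \<open>Equivariant bilinear forms\<close>

text \<open>On vertex vectors the form is a \<open>hecke_kernel\<close> in either order of its
  arguments, with base value \<open>\<beta> W1 W2\<close>. Vertex vectors span both spaces, so
  vanishing on them extends to one argument after the other.\<close>

lemma equivariant_form_vanishes:
  fixes s1 :: "'k :: field \<Rightarrow> 'v :: ab_group_add \<Rightarrow> 'v" and s2 :: "'k \<Rightarrow> 'w :: ab_group_add \<Rightarrow> 'w"
    and \<rho>1 :: "'p :: prime_card padic ^ 2 ^ 2 \<Rightarrow> 'v \<Rightarrow> 'v"
  assumes "spherical_vector s1 \<rho>1 W1" "spherical_vector s2 \<rho>2 W2"
    and lin1: "\<And>w. Vector_Spaces.linear s1 (*) (\<lambda>v. \<beta> v w)"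
    and lin2: "\<And>v. Vector_Spaces.linear s2 (*) (\<beta> v)"
    and equiv: "\<And>x v w. x \<in> mirabolic \<Longrightarrow> \<beta> (\<rho>1 x v) (\<rho>2 x w) = delta_P x * \<beta> v w"
    and p: "of_nat CARD('p) \<noteq> (0 :: 'k)" "of_nat (CARD('p) - 1) \<noteq> (0 :: 'k)"
    and \<omega>: "central_character s1 \<rho>1 padic_p * central_character s2 \<rho>2 padic_p \<noteq> 1"
    and base: "\<beta> W1 W2 = 0"
  shows "\<forall>v w. \<beta> v w = 0"
proof -
  interpret V: spherical_vector s1 \<rho>1 W1 by fact
  interpret W: spherical_vector s2 \<rho>2 W2 by fact
  interpret b1: Vector_Spaces.linear s1 "(*)" "\<lambda>v. \<beta> v w" for w by (rule lin1)
  interpret b2: Vector_Spaces.linear s2 "(*)" "\<beta> v" for v by (rule lin2)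
  define L where "L a b a' b' = \<beta> (V.E a b) (W.E a' b')" for a b a' b'
  obtain t1 where t1: "\<And>a b. a \<noteq> 0 \<Longrightarrow> (\<Sum>c<CARD('p). V.E (a * padic_p) (b + a * of_nat c)) +
      s1 (central_character s1 \<rho>1 padic_p) (V.E (a / padic_p) b) = s1 t1 (V.E a b)"
    by (rule V.hecke_relation) (rule that)
  obtain t2 where t2: "\<And>a b. a \<noteq> 0 \<Longrightarrow> (\<Sum>c<CARD('p). W.E (a * padic_p) (b + a * of_nat c)) +
      s2 (central_character s2 \<rho>2 padic_p) (W.E (a / padic_p) b) = s2 t2 (W.E a b)"
    by (rule W.hecke_relation) (rule that)
  have equivariant: "L (x * a) (x * b + y) (x * a') (x * b' + y) = delta_P (mtx x y 0 1) * L a b a' b'"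
    if "x \<noteq> 0" "a \<noteq> 0" "a' \<noteq> 0" for x y a b a' b'
    using equiv[OF mtx_mirabolic, of x y "V.E a b" "W.E a' b'"] that
    by (simp add: L_def V.act_E W.act_E)
  have hecke1: "(\<Sum>c<CARD('p). L (a * padic_p) (b + a * of_nat c) a' b')
      + central_character s1 \<rho>1 padic_p * L (a / padic_p) b a' b' = t1 * L a b a' b'"
    if "a \<noteq> 0" for a b a' b'
    using arg_cong[OF t1[OF that, of b], of "\<lambda>v. \<beta> v (W.E a' b')"]
    by (simp add: L_def b1.add b1.sum b1.scale)
  have hecke2: "(\<Sum>c<CARD('p). L a' b' (a * padic_p) (b + a * of_nat c))
      + central_character s2 \<rho>2 padic_p * L a' b' (a / padic_p) b = t2 * L a' b' a b"
    if "a \<noteq> 0" for a b a' b'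
    using arg_cong[OF t2[OF that, of b], of "\<beta> (V.E a' b')"]
    by (simp add: L_def b2.add b2.sum b2.scale)
  have L: "L a b a' b' = 0" if "a \<noteq> 0" "a' \<noteq> 0" for a b a' b'
  proof (rule hecke_kernel_vanishes[OF _ _ p(2) \<omega> _ that])
    show "hecke_kernel L (central_character s1 \<rho>1 padic_p) t1"
      by unfold_locales (simp_all add: equivariant hecke1 p, simp_all add: L_def V.E_unit W.E_unit V.E_shift W.E_shift)
    show "hecke_kernel (\<lambda>a b a' b'. L a' b' a b) (central_character s2 \<rho>2 padic_p) t2"
      by unfold_locales (simp_all add: equivariant hecke2 p, simp_all add: L_def V.E_unit W.E_unit V.E_shift W.E_shift)
    have "mtx 1 0 0 1 = (mat 1 :: 'p padic ^ 2 ^ 2)" by (simp add: mat_mtx)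
    then show "L 1 0 1 0 = 0"
      using V.rep W.rep base by (simp add: L_def V.E_def W.E_def GL2_representation_def)
  qed
  have 1: "\<beta> v (W.E a' b') = 0" if "a' \<noteq> 0" for v a' b'
  proof -
    have "V.subspace {v. \<beta> v (W.E a' b') = 0}"
      by (simp add: V.subspace_def b1.zero b1.add b1.scale)
    then have "V.span {V.E a b | a b. a \<noteq> 0} \<subseteq> {v. \<beta> v (W.E a' b') = 0}"
      using L[OF _ that] by (intro V.span_minimal) (auto simp: L_def)
    then show ?thesis using V.span_E by auto
  qed
  have "\<beta> v w = 0" for v w
  proof -
    have "W.subspace {w. \<beta> v w = 0}"
      by (simp add: W.subspace_def b2.zero b2.add b2.scale)
    then have "W.span {W.E a b | a b. a \<noteq> 0} \<subseteq> {w. \<beta> v w = 0}"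
      using 1 by (intro W.span_minimal) auto
    then show ?thesis using W.span_E by auto
  qed
  then show ?thesis by blast
qed

section \<open>Linear forms on the tensor product\<close>

lemma tensor_dual_bilinear:
  fixes s1 :: "'k :: field \<Rightarrow> 'v :: ab_group_add \<Rightarrow> 'v" and s2 :: "'k \<Rightarrow> 'w :: ab_group_add \<Rightarrow> 'w"
  assumes l: "l \<in> tensor_dual s1 s2" and "vector_space s1" "vector_space s2"
  shows "Vector_Spaces.linear s1 (*) (\<lambda>v. l (pure_tensor s1 s2 v w))"
    and "Vector_Spaces.linear s2 (*) (\<lambda>w. l (pure_tensor s1 s2 v w))"
proof -
  interpret s1: vector_space s1 by fact
  interpret s2: vector_space s2 by fact
  interpret k: vector_space "(*) :: 'k \<Rightarrow> 'k \<Rightarrow> 'k" by (rule vector_space_over_itself.vector_space_axioms)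
  have lin: "l (tensor_class s1 s2 (x + y)) = l (tensor_class s1 s2 x) + l (tensor_class s1 s2 y)"
      "l (tensor_class s1 s2 (free_scale c x)) = c * l (tensor_class s1 s2 x)" for x y c
    using l by (auto simp: tensor_dual_def tensor_space_def simp flip: tensor_add_class tensor_scale_class)
  \<comment> \<open>In each line the difference of the two representatives is one of the generators
    of \<open>tensor_null\<close>.\<close>
  have "pure_tensor s1 s2 (v + v') w = tensor_class s1 s2 (free_pair v w + free_pair v' w)"
    "pure_tensor s1 s2 v (w + w') = tensor_class s1 s2 (free_pair v w + free_pair v w')"
    "pure_tensor s1 s2 (s1 c v) w = tensor_class s1 s2 (free_scale c (free_pair v w))"
    "pure_tensor s1 s2 v (s2 c w) = tensor_class s1 s2 (free_scale c (free_pair v w))" for v v' w w' c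
    unfolding pure_tensor_def tensor_class_eq_iff tensor_null_def diff_diff_eq[symmetric]
    by (rule free.span_base, blast)+
  note pure = this[unfolded pure_tensor_def]
  show "Vector_Spaces.linear s1 (*) (\<lambda>v. l (pure_tensor s1 s2 v w))"
    by unfold_locales (simp_all add: pure_tensor_def pure lin)
  show "Vector_Spaces.linear s2 (*) (\<lambda>w. l (pure_tensor s1 s2 v w))"
    by unfold_locales (simp_all add: pure_tensor_def pure lin)
qed

text \<open>Both \<open>l\<close> and 0 induce the zero bilinear form, so the uniqueness half of
  \<open>tensor_universal\<close> identifies them.\<close>

lemma tensor_dual_eq_0:
  assumes l: "l \<in> tensor_dual s1 s2" and s: "vector_space s1" "vector_space s2"
    and 0: "\<And>v w. l (pure_tensor s1 s2 v w) = 0"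
  shows "l = 0"
proof -
  have "0 \<in> tensor_dual s1 s2" by (simp add: tensor_dual_def)
  moreover have "\<exists>!l. l \<in> tensor_dual s1 s2 \<and> (\<forall>v w. l (pure_tensor s1 s2 v w) = 0)"
    using tensor_dual_bilinear[OF l s] by (intro tensor_universal s) (simp_all add: 0)
  ultimately show ?thesis using l 0 by (metis zero_fun_apply)
qed

text \<open>Evaluation at a spherical pure tensor is thus injective on \<open>Hom_P\<close>, which
  yields both the dimension bound and the non-vanishing.\<close>

lemma Hom_P_eq_0:
  fixes s1 :: "'k :: field \<Rightarrow> 'v :: ab_group_add \<Rightarrow> 'v" and s2 :: "'k \<Rightarrow> 'w :: ab_group_add \<Rightarrow> 'w"
    and \<rho>1 :: "'p :: prime_card padic ^ 2 ^ 2 \<Rightarrow> 'v \<Rightarrow> 'v"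
  assumes sv: "spherical_vector s1 \<rho>1 W1" "spherical_vector s2 \<rho>2 W2"
    and l: "l \<in> Hom_P s1 \<rho>1 s2 \<rho>2"
    and p: "of_nat CARD('p) \<noteq> (0 :: 'k)" "of_nat (CARD('p) - 1) \<noteq> (0 :: 'k)"
    and \<omega>: "central_character s1 \<rho>1 padic_p * central_character s2 \<rho>2 padic_p \<noteq> 1"
    and base: "l (pure_tensor s1 s2 W1 W2) = 0"
  shows "l = 0"
proof -
  interpret V: spherical_vector s1 \<rho>1 W1 by fact
  interpret W: spherical_vector s2 \<rho>2 W2 by fact
  note vs = V.vector_space_axioms W.vector_space_axioms
  have dual: "l \<in> tensor_dual s1 s2" using l by (simp add: Hom_P_def)
  show ?thesis
  proof (rule tensor_dual_eq_0[OF dual vs])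
    have "\<forall>v w. l (pure_tensor s1 s2 v w) = 0"
    proof (rule equivariant_form_vanishes[OF sv tensor_dual_bilinear[OF dual vs] _ p \<omega> base])
      fix x :: "'p padic ^ 2 ^ 2" and v w assume x: "x \<in> mirabolic"
      then have G: "x \<in> GL2_Qp"
        by (auto simp: mirabolic_def mtx_def[symmetric] mtx_GL2_Qp_iff)
      have "pure_tensor s1 s2 v w \<in> tensor_space s1 s2"
        by (simp add: pure_tensor_def tensor_space_def)
      then have "l (tensor_map s1 s2 (\<rho>1 x) (\<rho>2 x) (pure_tensor s1 s2 v w))
          = delta_P x * l (pure_tensor s1 s2 v w)"
        using l x by (simp add: Hom_P_def)
      then show "l (pure_tensor s1 s2 (\<rho>1 x v) (\<rho>2 x w)) = delta_P x * l (pure_tensor s1 s2 v w)"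
        by (simp add: tensor_map_pure[OF V.linear_act[OF G] W.linear_act[OF G]])
    qed
    then show "l (pure_tensor s1 s2 v w) = 0" for v w by blast
  qed
qed

section \<open>Dimension bound and non-vanishing\<close>

lemma of_nat_alg_closure_eq_0_iff:
  "of_nat n = (0 :: 'l :: prime_card mod_ring alg_closure) \<longleftrightarrow> CARD('l) dvd n"
  by (simp add: of_nat_eq_0_iff_char_dvd)

theorem theorem6p6:
  fixes s1 :: "'l :: prime_card mod_ring alg_closure \<Rightarrow> 'v :: ab_group_add \<Rightarrow> 'v"
    and s2 :: "'l mod_ring alg_closure \<Rightarrow> 'w :: ab_group_add \<Rightarrow> 'w"
    and \<rho>1 :: "'p :: prime_card padic ^ 2 ^ 2 \<Rightarrow> 'v \<Rightarrow> 'v"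
    and \<rho>2 :: "'p padic ^ 2 ^ 2 \<Rightarrow> 'w \<Rightarrow> 'w"
  assumes "\<not> CARD('l) dvd CARD('p) * (CARD('p) - 1)"
    and "smooth_representation s1 \<rho>1" "unramified \<rho>1" "nondegenerate s1 \<rho>1"
    and "smooth_representation s2 \<rho>2" "unramified \<rho>2" "nondegenerate s2 \<rho>2"
    and "central_character s1 \<rho>1 padic_p \<noteq> inverse (central_character s2 \<rho>2 padic_p)"
  shows "(\<exists>B. finite B \<and> module.span fun_scale B = Hom_P s1 \<rho>1 s2 \<rho>2) \<and>
    vector_space.dim fun_scale (Hom_P s1 \<rho>1 s2 \<rho>2) \<le> 1 \<and>
    (\<forall>l \<in> Hom_P s1 \<rho>1 s2 \<rho>2. l \<noteq> 0 \<longrightarrow>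
      (\<forall>W1 \<in> spherical \<rho>1 - {0}. \<forall>W2 \<in> spherical \<rho>2 - {0}. l (pure_tensor s1 s2 W1 W2) \<noteq> 0))"
proof -
  let ?H = "Hom_P s1 \<rho>1 s2 \<rho>2"
  interpret f: vector_space "fun_scale :: 'l mod_ring alg_closure \<Rightarrow>
      ((('v \<times> 'w) \<Rightarrow>\<^sub>0 'l mod_ring alg_closure) set \<Rightarrow> 'l mod_ring alg_closure) \<Rightarrow> _"
    by (rule vector_space_fun_scale)
  have p: "of_nat CARD('p) \<noteq> (0 :: 'l mod_ring alg_closure)"
    "of_nat (CARD('p) - 1) \<noteq> (0 :: 'l mod_ring alg_closure)"
    using assms(1) unfolding of_nat_alg_closure_eq_0_iff by (auto intro: dvd_mult dvd_mult2)
  have \<omega>: "central_character s1 \<rho>1 padic_p * central_character s2 \<rho>2 padic_p \<noteq> 1"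
    using assms(8) by (metis inverse_unique mult.commute)
  have sv: "spherical_vector s1 \<rho>1 W1" "spherical_vector s2 \<rho>2 W2"
    if "W1 \<in> spherical \<rho>1 - {0}" "W2 \<in> spherical \<rho>2 - {0}" for W1 W2
    using that assms by (auto simp: spherical_vector_def smooth_representation_def)
  have nonvanishing: "l (pure_tensor s1 s2 W1 W2) \<noteq> 0"
    if "l \<in> ?H" "l \<noteq> 0" "W1 \<in> spherical \<rho>1 - {0}" "W2 \<in> spherical \<rho>2 - {0}" for l W1 W2
    using Hom_P_eq_0[OF sv[OF that(3,4)] that(1) p \<omega>] that(2) by blast
  obtain W1 W2 where W: "W1 \<in> spherical \<rho>1 - {0}" "W2 \<in> spherical \<rho>2 - {0}"
    using assms(3,6) by (auto simp: unramified_def)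
  have sub: "f.subspace ?H" by (rule Hom_P_subspace)
  \<comment> \<open>A spanning set is exhibited because \<open>dim\<close> defaults to 0 on
    infinite-dimensional spaces and a bound on it alone would not show finite dimension.\<close>
  obtain B where B: "finite B" "card B \<le> 1" "f.span B = ?H"
  proof (cases "?H \<subseteq> {0}")
    case True
    then have "?H = {0}" using f.subspace_0[OF sub] by blast
    then show thesis using that[of "{}"] by simp
  next
    case False
    then obtain l0 where l0: "l0 \<in> ?H" "l0 \<noteq> 0" by blast
    let ?T = "pure_tensor s1 s2 W1 W2"
    have "l0 ?T \<noteq> 0" using nonvanishing[OF l0 W] .
    have "l \<in> f.span {l0}" if l: "l \<in> ?H" for l
    proof -
      \<comment> \<open>The scalar is chosen so that the difference vanishes at \<open>?T\<close>;
        by \<open>nonvanishing\<close> it is then zero.\<close>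
      let ?c = "l ?T / l0 ?T"
      have "l - fun_scale ?c l0 \<in> ?H"
        using l l0(1) by (intro f.subspace_diff[OF sub] f.subspace_scale[OF sub])
      moreover have "(l - fun_scale ?c l0) ?T = 0"
        using \<open>l0 ?T \<noteq> 0\<close> by (simp add: fun_scale_def)
      ultimately have "l - fun_scale ?c l0 = 0" using nonvanishing W by blast
      then show ?thesis by (auto simp: f.span_singleton)
    qed
    then have "f.span {l0} = ?H" using f.span_minimal[OF _ sub, of "{l0}"] l0(1) by blast
    then show thesis using that[of "{l0}"] by simp
  qed
  have "f.dim ?H \<le> card B"
    using B(1,3) f.dim_le_card[of ?H B] by simp
  then have "f.dim ?H \<le> 1" using B(2) by simp
  then show ?thesis using B(1,3) nonvanishing by blast
qed

end
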